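(* There is a deterministic algorithm in the $\mathsf{CD}$ model that solves $\mathsf{Broadcast}$ on any $n$-vertex network in $O(nN^2\log N\log n)$ time using $O(\log^3 N\log n)$ energy.
   Context: Radio network: connected undirected graph with $n$ vertices; synchronized slots; each vertex transmits, listens or idles per slot, transmit/listen costing one unit of energy; energy = maximum per-vertex number of such slots. $\mathsf{CD}$: a listener receives the message if exactly one neighbor transmits, hears silence if none, and noise (distinguishable from silence) if at least two. Deterministic setting: vertices have distinct IDs in $\{1,\ldots,N\}$. $\mathsf{Broadcast}$: a source vertex holds a message that all vertices must learn. *)

theory Defs
  imports Complex_Main
begin

text \<open>Vertices are identified with their distinct IDs, so the vertex set V is a
subset of {1..N}. The edge relation E is symmetric, irreflexive and lives on V.\<close>

definition is_network :: "nat set \<Rightarrow> (nat \<Rightarrow> nat \<Rightarrow> bool) \<Rightarrow> bool" where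
  "is_network V E \<longleftrightarrow> finite V \<and> V \<noteq> {} \<and>
     (\<forall>u v. E u v \<longrightarrow> u \<in> V \<and> v \<in> V \<and> u \<noteq> v \<and> E v u) \<and>
     (\<forall>u\<in>V. \<forall>v\<in>V. E\<^sup>*\<^sup>* u v)"

text \<open>A transmitted packet: arbitrary auxiliary data (a list of naturals) and
optionally a broadcast message of type 'm.\<close>
type_synonym 'm packet = "nat list \<times> 'm option"

datatype 'm action = Idle | Listen | Transmit "'m packet"

datatype 'm feedback = NoFeedback | Silence | Noise | Received "'m packet"

text \<open>A deterministic algorithm: the action of a vertex in a slot is a function of
N, n, its ID, its input (Some m iff it is the source holding m) and its local history
of feedback so far. The output function similarly maps the local view to the
message learned (if any).\<close>
type_synonym 'm alg_act = "nat \<Rightarrow> nat \<Rightarrow> nat \<Rightarrow> 'm option \<Rightarrow> 'm feedback list \<Rightarrow> 'm action"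
type_synonym 'm alg_out = "nat \<Rightarrow> nat \<Rightarrow> nat \<Rightarrow> 'm option \<Rightarrow> 'm feedback list \<Rightarrow> 'm option"

definition input_of :: "nat \<Rightarrow> 'm \<Rightarrow> nat \<Rightarrow> 'm option" where
  "input_of s m v = (if v = s then Some m else None)"

definition cd_feedback :: "nat set \<Rightarrow> (nat \<Rightarrow> nat \<Rightarrow> bool) \<Rightarrow> (nat \<Rightarrow> 'm action) \<Rightarrow> nat \<Rightarrow> 'm feedback" where
  "cd_feedback V E a v =
     (case a v of
        Listen \<Rightarrow>
          (let T = {u \<in> V. E v u \<and> (\<exists>p. a u = Transmit p)} in
           if T = {} then Silence
           else if (\<exists>u. T = {u}) then
             (case a (the_elem T) of Transmit p \<Rightarrow> Received p | _ \<Rightarrow> Noise)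
           else Noise)
      | _ \<Rightarrow> NoFeedback)"

fun history :: "'m alg_act \<Rightarrow> nat \<Rightarrow> nat \<Rightarrow> nat set \<Rightarrow> (nat \<Rightarrow> nat \<Rightarrow> bool) \<Rightarrow> nat \<Rightarrow> 'm
                 \<Rightarrow> nat \<Rightarrow> nat \<Rightarrow> 'm feedback list" where
  "history act N n V E s m 0 = (\<lambda>v. [])"
| "history act N n V E s m (Suc t) =
     (let h = history act N n V E s m t;
          a = (\<lambda>v. act N n v (input_of s m v) (h v))
      in (\<lambda>v. h v @ [cd_feedback V E a v]))"

definition action_at :: "'m alg_act \<Rightarrow> nat \<Rightarrow> nat \<Rightarrow> nat set \<Rightarrow> (nat \<Rightarrow> nat \<Rightarrow> bool) \<Rightarrow> nat \<Rightarrow> 'm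
                 \<Rightarrow> nat \<Rightarrow> nat \<Rightarrow> 'm action" where
  "action_at act N n V E s m t v = act N n v (input_of s m v) (history act N n V E s m t v)"

definition energy_upto :: "'m alg_act \<Rightarrow> nat \<Rightarrow> nat \<Rightarrow> nat set \<Rightarrow> (nat \<Rightarrow> nat \<Rightarrow> bool) \<Rightarrow> nat \<Rightarrow> 'm
                 \<Rightarrow> nat \<Rightarrow> nat \<Rightarrow> nat" where
  "energy_upto act N n V E s m T v = card {t. t < T \<and> action_at act N n V E s m t v \<noteq> Idle}"

definition solves_broadcast :: "'m alg_act \<Rightarrow> 'm alg_out \<Rightarrow> nat \<Rightarrow> nat \<Rightarrow> nat set \<Rightarrow> (nat \<Rightarrow> nat \<Rightarrow> bool)
                 \<Rightarrow> nat \<Rightarrow> 'm \<Rightarrow> nat \<Rightarrow> real \<Rightarrow> bool" where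
  "solves_broadcast act out N n V E s m T En \<longleftrightarrow>
     (\<forall>v\<in>V. \<forall>t\<ge>T. action_at act N n V E s m t v = Idle) \<and>
     (\<forall>v\<in>V. real (energy_upto act N n V E s m T v) \<le> En) \<and>
     (\<forall>v\<in>V. out N n v (input_of s m v) (history act N n V E s m T v) = Some m)"

end

theory Submission
  imports Defs
begin

text \<open>The vertices are kept partitioned into clusters, each spanned by a rooted tree in which every
  vertex knows the key of its root, its depth and its parent. Keys are the identifiers, except that
  the source has key 0. In one pass every cluster hooks onto the neighbouring cluster with the
  smallest root key, provided that this key is smaller than its own. Two passes halve the number
  of clusters, so after \<open>O(log n)\<close> passes only the cluster of the source is left. The message
  travels together with the labels, so every member of that cluster knows it.

  A pass costs only \<open>O(log N)\<close> energy. Along the trees, slots are indexed by depth and parent, so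
  a vertex is awake in \<open>O(1)\<close> slots to compute the disjunction of a bit over its cluster; collision
  detection makes simultaneous children harmless. The smallest link out of a cluster is
  then found by binary search on its \<open>O(log N)\<close> bits. Hooks can form long chains, but keys
  decrease along them. Hence the clusters are relabelled one after the other in the order of their
  root keys, and a vertex that wants to hook knows in which slot its future parent,
  already relabelled, announces its new label.\<close>

section \<open>The algorithm\<close>

text \<open>Two kinds of communication behave differently under collisions. Combining a bit needs
  only silence versus anything else, so any number of senders is fine. Moving a label needs an
  intact packet, hence exactly one sending neighbour. This is why relabelling climbs only along the
  single path from the vertex holding the hooking link to the old root, reversing that path, and
  spreads to the rest of the cluster downwards, where a parent sends alone.

  The old tree stays frozen while the new one is built, because slot addresses must mean the same
  thing to sender and listener throughout a pass. The energy bound rests on the same fact: from its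
  frozen fields a vertex can name the few slots in which it may be awake.

  Key 0 is the minimum, so the source's cluster never hooks elsewhere; identifiers are positive, so
  all keys remain distinct.

  With \<open>M = 2 ^ K\<close>, at most \<open>2 * N\<close> in the final bounds, a search level
  costs about \<open>M * M + 2 * n * M\<close> slots and relabelling costs \<open>M\<close> stages
  of about \<open>2 * n * M\<close> slots. The listener knows its own identifier, so a level needs
  only \<open>M * M\<close> probe slots although link codes have \<open>3 * K\<close> bits.\<close>

text \<open>\<open>root\<close>, \<open>dep\<close>, \<open>par\<close> describe the tree used for communication in the current pass, and
  \<open>nroot\<close>, \<open>ndep\<close>, \<open>npar\<close> the tree being built for the next one. \<open>cur\<close> is the prefix of the smallest
  link code that is known to the cluster, and \<open>flag\<close> the bit to be combined over the cluster.
  \<open>settled\<close> says that the new labels are final.\<close>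

record 'm st =
  root :: nat
  dep :: nat
  par :: nat
  nroot :: nat
  ndep :: nat
  npar :: nat
  msg :: "'m option"
  cur :: nat
  flag :: bool
  settled :: bool

text \<open>\<open>Probe b q\<close> tests for a link code with a given prefix (bit \<open>b\<close>, restricted code \<open>q\<close> of the
  sender). \<open>Up d p\<close> is reserved for the children of \<open>p\<close> at depth \<open>d\<close>, \<open>Down d p\<close> for \<open>p\<close> at depth \<open>d\<close>,
  and likewise for the relabelling slots, whose first argument is the root key of the active
  cluster. \<open>Start\<close>, \<open>Shift\<close> and \<open>Decide\<close> are local computations during which all vertices idle.\<close>

datatype slot =
    Start
  | Probe nat nat
  | Up nat nat
  | Down nat nat
  | Shift
  | Decide
  | Relabel_Up nat nat nat
  | Relabel_Down nat nat nat
  | Announce nat nat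

text \<open>A link from \<open>u\<close> to \<open>w\<close> has the code \<open>(root w * 2 ^ K + w) * 2 ^ K + u\<close>. Its prefix above
  bit \<open>b\<close> depends only on \<open>w\<close> when \<open>K \<le> b\<close>; below, the listener contributes bits of its own.
  The sender uses the slot \<open>q = (root w * 2 ^ K + w) div 2 ^ (b - K)\<close> in both cases, where
  truncated subtraction yields the full code of \<open>w\<close> if \<open>b < K\<close>.\<close>

definition probe_val :: "nat \<Rightarrow> nat \<Rightarrow> nat \<Rightarrow> nat \<Rightarrow> nat" where
  "probe_val K b q v = (if K \<le> b then q else q * 2 ^ (K - b) + v div 2 ^ b)"

definition hook_root :: "nat \<Rightarrow> nat \<Rightarrow> nat" where
  "hook_root K c = c div 2 ^ K div 2 ^ K"

definition hook_via :: "nat \<Rightarrow> nat \<Rightarrow> nat" where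
  "hook_via K c = c div 2 ^ K mod 2 ^ K"

definition hook_from :: "nat \<Rightarrow> nat \<Rightarrow> nat" where
  "hook_from K c = c mod 2 ^ K"

definition label_packet :: "nat \<Rightarrow> 'm st \<Rightarrow> 'm packet" where
  "label_packet v x = ([nroot x, ndep x, v], msg x)"

text \<open>A \<open>Probe\<close> listener waits for the one slot in which the sender's code,
  completed by its own bits, has prefix \<open>2 * cur x\<close>: it asks whether the next bit of
  the minimum is 0. In relabelling slots only settled vertices send and only unsettled ones listen,
  so final labels are never overwritten.\<close>

fun emit :: "nat \<Rightarrow> nat \<Rightarrow> slot \<Rightarrow> 'm st \<Rightarrow> 'm action" where
  "emit K v (Probe b q) x =
     (if (root x * 2 ^ K + v) div 2 ^ (b - K) = q then Transmit ([], None)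
      else if probe_val K b q v = 2 * cur x then Listen else Idle)"
| "emit K v (Up d p) x =
     (if dep x = d \<and> par x = p \<and> flag x then Transmit ([], None)
      else if v = p \<and> Suc (dep x) = d then Listen else Idle)"
| "emit K v (Down d p) x =
     (if v = p \<and> dep x = d \<and> flag x then Transmit ([], None)
      else if par x = p \<and> dep x = Suc d then Listen else Idle)"
| "emit K v (Relabel_Up r d p) x =
     (if root x = r \<and> dep x = d \<and> par x = p \<and> settled x then Transmit (label_packet v x)
      else if root x = r \<and> v = p \<and> Suc (dep x) = d \<and> \<not> settled x then Listen else Idle)"
| "emit K v (Relabel_Down r d p) x =
     (if root x = r \<and> v = p \<and> dep x = d \<and> settled x then Transmit (label_packet v x)
      else if root x = r \<and> par x = p \<and> dep x = Suc d \<and> \<not> settled x then Listen else Idle)"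
| "emit K v (Announce r w) x =
     (if root x = r \<and> v = w \<and> settled x then Transmit (label_packet v x)
      else if hook_root K (cur x) = r \<and> hook_via K (cur x) = w \<and> hook_from K (cur x) = v
        \<and> \<not> settled x then Listen else Idle)"
| "emit K v _ x = Idle"

text \<open>The sender becomes the parent, whatever its place in the old tree; packets that travel
  upwards therefore reverse tree edges. \<open>root\<close>, \<open>dep\<close> and
  \<open>par\<close> stay untouched, since they address the remaining slots of the pass.\<close>

fun adopt :: "'m feedback \<Rightarrow> 'm st \<Rightarrow> 'm st" where
  "adopt (Received ([r, d, u], mo)) x =
     x\<lparr>nroot := r, ndep := Suc d, npar := u, msg := mo, settled := True\<rparr>"
| "adopt _ x = x"

text \<open>A vertex that transmits in its own \<open>Probe\<close> slot gets \<open>NoFeedback\<close>, which differs from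
  \<open>Silence\<close>, so its flag is set for its own code without listening.\<close>

fun upd :: "nat \<Rightarrow> nat \<Rightarrow> slot \<Rightarrow> 'm st \<Rightarrow> 'm feedback \<Rightarrow> 'm st" where
  "upd K v Start x fb =
     x\<lparr>root := nroot x, dep := ndep x, par := npar x, cur := 0, flag := False, settled := False\<rparr>"
| "upd K v (Probe b q) x fb =
     (if probe_val K b q v = 2 * cur x then x\<lparr>flag := (fb \<noteq> Silence)\<rparr> else x)"
| "upd K v (Up d p) x fb =
     (if v = p \<and> Suc (dep x) = d \<and> fb \<noteq> Silence then x\<lparr>flag := True\<rparr> else x)"
| "upd K v (Down d p) x fb =
     (if par x = p \<and> dep x = Suc d then x\<lparr>flag := (fb \<noteq> Silence)\<rparr> else x)"
| "upd K v Shift x fb =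
     x\<lparr>cur := (if flag x then 2 * cur x else Suc (2 * cur x)), flag := False\<rparr>"
| "upd K v Decide x fb = x\<lparr>settled := (hook_root K (cur x) = root x)\<rparr>"
| "upd K v (Relabel_Up r d p) x fb = adopt fb x"
| "upd K v (Relabel_Down r d p) x fb = adopt fb x"
| "upd K v (Announce r w) x fb = adopt fb x"

definition grid :: "(nat \<Rightarrow> nat \<Rightarrow> slot) \<Rightarrow> nat list \<Rightarrow> nat \<Rightarrow> slot list" where
  "grid f ds M = concat (map (\<lambda>d. map (f d) [0..<M]) ds)"

definition cast_slots :: "nat \<Rightarrow> nat \<Rightarrow> slot list" where
  "cast_slots K n = grid Up (rev [1..<n]) (2 ^ K) @ grid Down [0..<n] (2 ^ K)"

definition level_slots :: "nat \<Rightarrow> nat \<Rightarrow> nat \<Rightarrow> slot list" where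
  "level_slots K n b = map (Probe b) [0..<2 ^ K * 2 ^ K] @ cast_slots K n"

definition search_slots :: "nat \<Rightarrow> nat \<Rightarrow> slot list" where
  "search_slots K n = concat (map (\<lambda>b. level_slots K n b @ [Shift]) (rev [0..<3 * K]))"

definition stage_slots :: "nat \<Rightarrow> nat \<Rightarrow> nat \<Rightarrow> slot list" where
  "stage_slots K n r = grid (Relabel_Up r) (rev [1..<n]) (2 ^ K)
     @ grid (Relabel_Down r) [0..<n] (2 ^ K) @ map (Announce r) [0..<2 ^ K]"

definition relabel_slots :: "nat \<Rightarrow> nat \<Rightarrow> slot list" where
  "relabel_slots K n = concat (map (stage_slots K n) [0..<2 ^ K])"

definition pass_slots :: "nat \<Rightarrow> nat \<Rightarrow> slot list" where
  "pass_slots K n = [Start] @ search_slots K n @ [Decide] @ relabel_slots K n"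

definition bits :: "nat \<Rightarrow> nat" where
  "bits k = Suc (nat \<lfloor>log 2 (real k)\<rfloor>)"

definition schedule :: "nat \<Rightarrow> nat \<Rightarrow> slot list" where
  "schedule N n = concat (replicate (2 * bits n) (pass_slots (bits N) n))"

definition init_st :: "nat \<Rightarrow> 'm option \<Rightarrow> 'm st" where
  "init_st v inp = \<lparr>root = 0, dep = 0, par = 0, nroot = (if inp = None then v else 0), ndep = 0,
     npar = 0, msg = inp, cur = 0, flag = False, settled = False\<rparr>"

text \<open>The model offers only the feedback history, so a vertex recomputes its state by
  replaying the schedule on it. \<open>zip\<close> stops at the end of the history, that is, at the
  present slot.\<close>

definition local_st :: "nat \<Rightarrow> nat \<Rightarrow> nat \<Rightarrow> 'm option \<Rightarrow> 'm feedback list \<Rightarrow> 'm st" where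
  "local_st N n v inp h =
     fold (\<lambda>(l, fb) x. upd (bits N) v l x fb) (zip (schedule N n) h) (init_st v inp)"

definition bc_act :: "'m alg_act" where
  "bc_act N n v inp h = (if length h < length (schedule N n)
     then emit (bits N) v (schedule N n ! length h) (local_st N n v inp h) else Idle)"

definition bc_out :: "'m alg_out" where
  "bc_out N n v inp h = msg (local_st N n v inp h)"


section \<open>Global execution of a slot list\<close>

lemma cd_feedback_silence_iff:
  "cd_feedback V E a v = Silence \<longleftrightarrow>
     a v = Listen \<and> (\<forall>u\<in>V. E v u \<longrightarrow> (\<forall>p. a u \<noteq> Transmit p))"
proof (cases "a v = Listen")
  case True
  define T where "T = {u \<in> V. E v u \<and> (\<exists>p. a u = Transmit p)}"
  have eq: "cd_feedback V E a v = (if T = {} then Silence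
           else if (\<exists>u. T = {u}) then
             (case a (the_elem T) of Transmit p \<Rightarrow> Received p | _ \<Rightarrow> Noise)
           else Noise)"
    unfolding cd_feedback_def Let_def T_def True action.case by (rule refl)
  have "cd_feedback V E a v = Silence \<longleftrightarrow> T = {}"
    unfolding eq by (auto split: action.splits)
  then show ?thesis
    using True by (auto simp: T_def)
qed (auto simp: cd_feedback_def split: action.splits)

lemma cd_feedback_receivedD:
  assumes "cd_feedback V E a v = Received p"
  shows "a v = Listen" "\<exists>u\<in>V. E v u \<and> a u = Transmit p"
proof -
  define T where "T = {u \<in> V. E v u \<and> (\<exists>p. a u = Transmit p)}"
  show L: "a v = Listen"
    using assms by (auto simp: cd_feedback_def split: action.splits)
  have eq: "cd_feedback V E a v = (if T = {} then Silence
           else if (\<exists>u. T = {u}) then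
             (case a (the_elem T) of Transmit p \<Rightarrow> Received p | _ \<Rightarrow> Noise)
           else Noise)"
    unfolding cd_feedback_def Let_def T_def L action.case by (rule refl)
  obtain u where u: "T = {u}"
    using assms unfolding eq by (auto split: if_splits)
  then have "u \<in> T" by simp
  moreover have "a u = Transmit p"
    using assms unfolding eq by (simp add: u split: action.splits)
  ultimately show "\<exists>u\<in>V. E v u \<and> a u = Transmit p"
    by (auto simp: T_def)
qed

lemma cd_feedback_unique:
  assumes "a v = Listen" "u \<in> V" "E v u" "a u = Transmit p"
    and "\<And>w q. w \<in> V \<Longrightarrow> E v w \<Longrightarrow> a w = Transmit q \<Longrightarrow> w = u"
  shows "cd_feedback V E a v = Received p"
proof -
  have "{u \<in> V. E v u \<and> (\<exists>p. a u = Transmit p)} = {u}"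
    using assms by blast
  then show ?thesis
    using assms(1,4) by (simp add: cd_feedback_def)
qed

lemma cd_feedback_not_received:
  assumes "u \<in> V" "E v u" "a u = Transmit p" "w \<in> V" "E v w" "a w = Transmit q" "u \<noteq> w"
  shows "cd_feedback V E a v \<noteq> Received r"
proof
  assume r: "cd_feedback V E a v = Received r"
  define T where "T = {u \<in> V. E v u \<and> (\<exists>p. a u = Transmit p)}"
  have "u \<in> T" "w \<in> T"
    using assms unfolding T_def by blast+
  then have "T \<noteq> {}" "\<not> (\<exists>u. T = {u})"
    using assms(7) by auto
  moreover have "a v = Listen"
    using cd_feedback_receivedD[OF r] by blast
  ultimately show False
    using r unfolding cd_feedback_def Let_def T_def[symmetric] by simp
qed

section \<open>Local replay versus global execution\<close>

definition step :: "nat \<Rightarrow> nat set \<Rightarrow> (nat \<Rightarrow> nat \<Rightarrow> bool) \<Rightarrow> slot \<Rightarrow> (nat \<Rightarrow> 'm st) \<Rightarrow> nat \<Rightarrow> 'm st" where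
  "step K V E l \<sigma> = (\<lambda>v. upd K v l (\<sigma> v) (cd_feedback V E (\<lambda>u. emit K u l (\<sigma> u)) v))"

definition run :: "nat \<Rightarrow> nat set \<Rightarrow> (nat \<Rightarrow> nat \<Rightarrow> bool) \<Rightarrow> slot list \<Rightarrow> (nat \<Rightarrow> 'm st) \<Rightarrow> nat \<Rightarrow> 'm st" where
  "run K V E ls \<sigma> = fold (step K V E) ls \<sigma>"

lemma run_simps [simp]:
  "run K V E [] \<sigma> = \<sigma>"
  "run K V E (l # ls) \<sigma> = run K V E ls (step K V E l \<sigma>)"
  "run K V E (ls @ ls') \<sigma> = run K V E ls' (run K V E ls \<sigma>)"
  by (simp_all add: run_def)

primrec energy :: "nat \<Rightarrow> nat set \<Rightarrow> (nat \<Rightarrow> nat \<Rightarrow> bool) \<Rightarrow> nat \<Rightarrow> slot list \<Rightarrow> (nat \<Rightarrow> 'm st) \<Rightarrow> nat" where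
  "energy K V E v [] \<sigma> = 0"
| "energy K V E v (l # ls) \<sigma> =
     (if emit K v l (\<sigma> v) = Idle then 0 else 1) + energy K V E v ls (step K V E l \<sigma>)"

lemma energy_append [simp]:
  "energy K V E v (ls @ ls') \<sigma> = energy K V E v ls \<sigma> + energy K V E v ls' (run K V E ls \<sigma>)"
  by (induction ls arbitrary: \<sigma>) auto

lemma history_simulates:
  assumes "t \<le> length (schedule N n)"
  shows "length (history bc_act N n V E s m t v) = t \<and>
    local_st N n v (input_of s m v) (history bc_act N n V E s m t v)
      = run (bits N) V E (take t (schedule N n)) (\<lambda>v. init_st v (input_of s m v)) v"
  using assms
proof (induction t arbitrary: v)
  case 0
  show ?case by (simp add: local_st_def)
next
  case (Suc t)
  define S where "S = schedule N n"
  define \<sigma> where "\<sigma> = run (bits N) V E (take t S) (\<lambda>v. init_st v (input_of s m v))"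
  define h where "h = history bc_act N n V E s m t"
  have t: "t < length S"
    using Suc.prems by (simp add: S_def)
  have IH: "length (h v) = t" "local_st N n v (input_of s m v) (h v) = \<sigma> v" for v
    using Suc by (simp_all add: S_def \<sigma>_def h_def)
  have act: "bc_act N n v (input_of s m v) (h v) = emit (bits N) v (S ! t) (\<sigma> v)" for v
    using t by (simp add: bc_act_def IH S_def)
  define f where "f = cd_feedback V E (\<lambda>u. emit (bits N) u (S ! t) (\<sigma> u)) v"
  have hist: "history bc_act N n V E s m (Suc t) v = h v @ [f]"
    by (simp add: Let_def h_def[symmetric] act f_def)
  have z: "zip S (h v @ [f]) = zip S (h v) @ [(S ! t, f)]"
  proof -
    have "zip S (h v @ [f]) = zip (take t S) (h v) @ zip (drop t S) [f]"
      by (simp add: zip_append2 IH)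
    also have "drop t S = S ! t # drop (Suc t) S"
      using t by (rule Cons_nth_drop_Suc[symmetric])
    also have "zip (take t S) (h v) = zip S (h v)"
      using zip_append2[of S "h v" "[]"] by (simp add: IH)
    finally show ?thesis by simp
  qed
  have "local_st N n v (input_of s m v) (h v @ [f]) = upd (bits N) v (S ! t) (\<sigma> v) f"
    using IH(2)[of v] by (simp add: local_st_def S_def[symmetric] z)
  also have "\<dots> = run (bits N) V E (take (Suc t) S) (\<lambda>v. init_st v (input_of s m v)) v"
    using t by (simp add: take_Suc_conv_app_nth \<sigma>_def[symmetric]) (simp add: step_def f_def)
  finally show ?case
    unfolding hist by (simp add: IH S_def)
qed

lemma action_at_simulates:
  assumes "t < length (schedule N n)"
  shows "action_at bc_act N n V E s m t v = emit (bits N) v (schedule N n ! t)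
    (run (bits N) V E (take t (schedule N n)) (\<lambda>v. init_st v (input_of s m v)) v)"
  using assms history_simulates[of t N n V E s m v] by (simp add: action_at_def bc_act_def)

lemma energy_upto_simulates:
  assumes "t \<le> length (schedule N n)"
  shows "energy_upto bc_act N n V E s m t v
    = energy (bits N) V E v (take t (schedule N n)) (\<lambda>v. init_st v (input_of s m v))"
  using assms
proof (induction t)
  case 0
  show ?case by (simp add: energy_upto_def)
next
  case (Suc t)
  let ?A = "\<lambda>t. action_at bc_act N n V E s m t v"
  have "{i. i < Suc t \<and> ?A i \<noteq> Idle} =
      {i. i < t \<and> ?A i \<noteq> Idle} \<union> (if ?A t = Idle then {} else {t})"
    by (auto simp: less_Suc_eq)
  then have "card {i. i < Suc t \<and> ?A i \<noteq> Idle} =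
      card {i. i < t \<and> ?A i \<noteq> Idle} + (if ?A t = Idle then 0 else 1)"
    by (simp add: card_insert_if)
  then show ?case
    using Suc by (simp add: energy_upto_def take_Suc_conv_app_nth action_at_simulates)
qed

section \<open>Energy and length of the schedule\<close>

lemma adopt_simps [simp]:
  "root (adopt fb x) = root x" "dep (adopt fb x) = dep x" "par (adopt fb x) = par x"
  "cur (adopt fb x) = cur x"
  by (cases "(fb, x)" rule: adopt.cases; simp)+

text \<open>Between two occurrences of \<open>Start\<close> or \<open>Shift\<close> the fields that
  address slots are constant. This makes the awake slots of a vertex predictable and gives all
  energy bounds.\<close>

lemma step_preserves_labels:
  assumes "l \<noteq> Start" "l \<noteq> Shift"
  shows "root (step K V E l \<sigma> v) = root (\<sigma> v)" "dep (step K V E l \<sigma> v) = dep (\<sigma> v)"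
    "par (step K V E l \<sigma> v) = par (\<sigma> v)" "cur (step K V E l \<sigma> v) = cur (\<sigma> v)"
  using assms by (cases l; simp add: step_def)+

text \<open>\<open>flag\<close> and \<open>settled\<close> do change during \<open>ls\<close>, so
  \<open>A\<close> must cover the awake slots for every state that shares the four frozen fields
  with the initial one.\<close>

lemma energy_le_filter:
  fixes \<sigma> :: "nat \<Rightarrow> 'm st"
  assumes "\<And>l (x :: 'm st). l \<in> set ls \<Longrightarrow> root x = root (\<sigma> v) \<Longrightarrow> dep x = dep (\<sigma> v) \<Longrightarrow> par x = par (\<sigma> v)
      \<Longrightarrow> cur x = cur (\<sigma> v) \<Longrightarrow> emit K v l x \<noteq> Idle \<Longrightarrow> l \<in> A"
    and "Start \<notin> set ls" "Shift \<notin> set ls"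
  shows "energy K V E v ls \<sigma> \<le> length (filter (\<lambda>l. l \<in> A) ls)"
  using assms
proof (induction ls arbitrary: \<sigma>)
  case (Cons l ls)
  have "energy K V E v ls (step K V E l \<sigma>) \<le> length (filter (\<lambda>l. l \<in> A) ls)"
    using Cons.prems by (intro Cons.IH) (auto simp: step_preserves_labels)
  then show ?case
    using Cons.prems(1)[of l "\<sigma> v"] by auto
qed simp

lemma energy_le_card:
  fixes \<sigma> :: "nat \<Rightarrow> 'm st"
  assumes "\<And>l (x :: 'm st). l \<in> set ls \<Longrightarrow> root x = root (\<sigma> v) \<Longrightarrow> dep x = dep (\<sigma> v) \<Longrightarrow> par x = par (\<sigma> v)
      \<Longrightarrow> cur x = cur (\<sigma> v) \<Longrightarrow> emit K v l x \<noteq> Idle \<Longrightarrow> l \<in> A"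
    and "Start \<notin> set ls" "Shift \<notin> set ls" "distinct ls" "finite A"
  shows "energy K V E v ls \<sigma> \<le> card A"
proof -
  have "energy K V E v ls \<sigma> \<le> length (filter (\<lambda>l. l \<in> A) ls)"
    using assms(1-3) by (rule energy_le_filter)
  also have "\<dots> = card (set (filter (\<lambda>l. l \<in> A) ls))"
    using assms(4) by (simp only: distinct_card distinct_filter)
  also have "\<dots> \<le> card A"
    using assms(5) by (intro card_mono) auto
  finally show ?thesis .
qed

lemma set_grid: "set (grid f ds M) = {f d p |d p. d \<in> set ds \<and> p < M}"
  unfolding grid_def by auto blast

lemma length_grid: "length (grid f ds M) = length ds * M"
  by (simp add: grid_def length_concat comp_def sum_list_triv)

lemma distinct_grid:
  assumes "\<And>d p d' p'. f d p = f d' p' \<Longrightarrow> d = d' \<and> p = p'" "distinct ds"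
  shows "distinct (grid f ds M)"
  using assms(2)
proof (induction ds)
  case (Cons d ds)
  then have "distinct (grid f ds M)" by simp
  moreover have "distinct (map (f d) [0..<M])"
    using assms(1) by (auto simp: distinct_map inj_on_def)
  moreover have "set (map (f d) [0..<M]) \<inter> set (grid f ds M) = {}"
    using Cons.prems by (auto simp: set_grid dest: assms(1))
  moreover have "grid f (d # ds) M = map (f d) [0..<M] @ grid f ds M"
    by (simp add: grid_def)
  ultimately show ?case
    by (simp only: distinct_append)
qed (simp add: grid_def)

lemma card_6: "card {a, b, c, d, e, f} \<le> 6"
proof -
  have "card (set [a, b, c, d, e, f]) \<le> length [a, b, c, d, e, f]"
    by (rule card_length)
  then show ?thesis by simp
qed

text \<open>Solved for \<open>q\<close>, the listening condition leaves at most one candidate slot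
  per level. If there is no solution, truncated subtraction yields some irrelevant slot.\<close>

lemma probe_val_eqD:
  assumes "probe_val K b q v = c"
  shows "q = (if K \<le> b then c else (c - v div 2 ^ b) div 2 ^ (K - b))"
  using assms by (auto simp: probe_val_def)

lemma level_energy: "energy K V E v (level_slots K n b) \<sigma> \<le> 6"
proof -
  define q where "q = (if K \<le> b then 2 * cur (\<sigma> v)
    else (2 * cur (\<sigma> v) - v div 2 ^ b) div 2 ^ (K - b))"
  \<comment> \<open>One sending and one listening slot for each of \<open>Probe\<close>,
    \<open>Up\<close> and \<open>Down\<close>. At depth 0 the entry with
    \<open>dep (\<sigma> v) - 1\<close> is spurious and only enlarges the set.\<close>
  define A where "A = {Probe b ((root (\<sigma> v) * 2 ^ K + v) div 2 ^ (b - K)), Probe b q,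
    Up (dep (\<sigma> v)) (par (\<sigma> v)), Up (Suc (dep (\<sigma> v))) v,
    Down (dep (\<sigma> v)) v, Down (dep (\<sigma> v) - 1) (par (\<sigma> v))}"
  have "energy K V E v (level_slots K n b) \<sigma> \<le> card A"
  proof (rule energy_le_card)
    fix l and x :: "'a st"
    assume l: "l \<in> set (level_slots K n b)" and eq: "root x = root (\<sigma> v)" "dep x = dep (\<sigma> v)"
      "par x = par (\<sigma> v)" "cur x = cur (\<sigma> v)" and "emit K v l x \<noteq> Idle"
    then show "l \<in> A"
      unfolding level_slots_def cast_slots_def A_def
      by (auto simp: set_grid q_def split: if_splits dest!: probe_val_eqD)
  next
    show "distinct (level_slots K n b)"
      unfolding level_slots_def cast_slots_def
      by (auto simp: set_grid distinct_map inj_on_def intro!: distinct_grid)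
  qed (auto simp: level_slots_def cast_slots_def set_grid A_def)
  also have "\<dots> \<le> 6"
    unfolding A_def by (rule card_6)
  finally show ?thesis .
qed

lemma search_energy: "energy K V E v (search_slots K n) \<sigma> \<le> 18 * K"
proof -
  have "energy K V E v (concat (map (\<lambda>b. level_slots K n b @ [Shift]) bs)) \<sigma> \<le> 6 * length bs" for bs
  proof (induction bs arbitrary: \<sigma>)
    case (Cons b bs)
    show ?case
      using add_mono[OF level_energy[of K V E v n b \<sigma>]
          Cons.IH[of "step K V E Shift (run K V E (level_slots K n b) \<sigma>)"]] by simp
  qed simp
  from this[of "rev [0..<3 * K]"] show ?thesis
    by (simp add: search_slots_def)
qed

lemma distinct_relabel_slots: "distinct (relabel_slots K n)"
proof -
  have st: "\<exists>d p. l = Relabel_Up r d p \<or> l = Relabel_Down r d p \<or> l = Announce r p"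
    if "l \<in> set (stage_slots K n r)" for l r
    using that by (auto simp: stage_slots_def set_grid)
  have d: "distinct (stage_slots K n r)" for r
    by (auto simp: stage_slots_def set_grid distinct_map inj_on_def intro!: distinct_grid)
  have "distinct (concat (map (stage_slots K n) rs))" if "distinct rs" for rs
    using that
  proof (induction rs)
    case (Cons r rs)
    then show ?case
      using d by (fastforce dest!: st)
  qed simp
  then show ?thesis
    by (simp add: relabel_slots_def)
qed

text \<open>Every relabelling slot carries a root key, so a vertex is awake only in the stage of its
  own cluster and in the announcement of its hooking target. The number of stages therefore does not
  enter.\<close>

lemma relabel_energy: "energy K V E v (relabel_slots K n) \<sigma> \<le> 6"
proof -
  let ?r = "root (\<sigma> v)" and ?d = "dep (\<sigma> v)" and ?p = "par (\<sigma> v)" and ?c = "cur (\<sigma> v)"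
  define A where "A = {Relabel_Up ?r ?d ?p, Relabel_Up ?r (Suc ?d) v, Relabel_Down ?r ?d v,
    Relabel_Down ?r (?d - 1) ?p, Announce ?r v, Announce (hook_root K ?c) (hook_via K ?c)}"
  have "energy K V E v (relabel_slots K n) \<sigma> \<le> card A"
  proof (rule energy_le_card)
    fix l and x :: "'a st"
    assume l: "l \<in> set (relabel_slots K n)" and eq: "root x = root (\<sigma> v)" "dep x = dep (\<sigma> v)"
      "par x = par (\<sigma> v)" "cur x = cur (\<sigma> v)" and "emit K v l x \<noteq> Idle"
    then show "l \<in> A"
      unfolding relabel_slots_def stage_slots_def A_def
      by (auto simp: set_grid split: if_splits)
  qed (auto simp: relabel_slots_def stage_slots_def set_grid A_def distinct_relabel_slots
        distinct_relabel_slots[unfolded relabel_slots_def])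
  also have "\<dots> \<le> 6"
    unfolding A_def by (rule card_6)
  finally show ?thesis .
qed

lemma pass_energy: "energy K V E v (pass_slots K n) \<sigma> \<le> 18 * K + 6"
proof -
  have [simp]: "energy K V E v [l] \<sigma>' = 0" if "l = Start \<or> l = Decide" for l and \<sigma>' :: "nat \<Rightarrow> 'a st"
    using that by auto
  show ?thesis
    using search_energy[of K V E v n "step K V E Start \<sigma>"] relabel_energy[of K V E v n
        "step K V E Decide (run K V E (search_slots K n) (step K V E Start \<sigma>))"]
    by (simp add: pass_slots_def)
qed

lemma passes_energy:
  "energy K V E v (concat (replicate k (pass_slots K n))) \<sigma> \<le> k * (18 * K + 6)"
proof (induction k arbitrary: \<sigma>)
  case (Suc k)
  show ?case
    using add_mono[OF pass_energy[of K V E v n \<sigma>] Suc.IH[of "run K V E (pass_slots K n) \<sigma>"]] by simp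
qed simp

section \<open>Length of a pass and size of \<open>bits\<close>\<close>

lemma length_pass_slots:
  assumes "n \<ge> 1"
  shows "length (pass_slots K n) \<le> (12 * K + 5) * (n * (2 ^ K) ^ 2)"
proof -
  define M :: nat where "M = 2 ^ K"
  have M: "M \<ge> 1" by (simp add: M_def)
  have level: "length (level_slots K n b @ [Shift]) \<le> 4 * (n * M ^ 2)" for b
  proof -
    have "length (level_slots K n b @ [Shift]) = M * M + (n - 1) * M + n * M + 1"
      by (simp add: level_slots_def cast_slots_def length_grid M_def)
    also have "\<dots> \<le> n * M^2 + n * M^2 + n * M^2 + n * M^2"
    proof -
      have "M * M \<le> n * M\<^sup>2" "1 \<le> n * M\<^sup>2"
        using M assms by (auto simp: power2_eq_square)
      moreover have "n * M \<le> n * M\<^sup>2"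
        using M by (simp add: power2_eq_square)
      moreover have "(n - 1) * M \<le> n * M"
        by simp
      ultimately show ?thesis by linarith
    qed
    finally show ?thesis by simp
  qed
  have "length (concat (map (\<lambda>b. level_slots K n b @ [Shift]) bs)) \<le> length bs * (4 * (n * M ^ 2))" for bs
  proof (induction bs)
    case (Cons b bs)
    show ?case
      using add_mono[OF level[of b] Cons.IH] by simp
  qed simp
  from this[of "rev [0..<3 * K]"] have search: "length (search_slots K n) \<le> 3 * K * (4 * (n * M ^ 2))"
    by (simp add: search_slots_def)
  have stage: "length (stage_slots K n r) \<le> 3 * (n * M)" for r
  proof -
    have "length (stage_slots K n r) = (n - 1) * M + n * M + M"
      by (simp add: stage_slots_def length_grid M_def)
    also have "\<dots> \<le> n * M + n * M + n * M"
      using assms by (intro add_mono) (auto intro!: mult_mono)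
    finally show ?thesis by simp
  qed
  have "length (concat (map (stage_slots K n) rs)) \<le> length rs * (3 * (n * M))" for rs
    using stage by (induction rs) (auto intro: add_mono)
  from this[of "[0..<M]"] have relabel: "length (relabel_slots K n) \<le> 3 * (n * M ^ 2)"
    by (simp add: relabel_slots_def M_def power2_eq_square mult_ac)
  \<comment> \<open>The two slots \<open>Start\<close> and \<open>Decide\<close>. With 4 units for
    each of the \<open>3 * K\<close> levels and 3 for relabelling this gives
    \<open>12 * K + 5\<close>.\<close>
  have "2 \<le> 2 * (n * M ^ 2)"
    using M assms by simp
  then have "length (pass_slots K n) \<le> 2 * (n * M ^ 2) + 3 * K * (4 * (n * M ^ 2)) + 3 * (n * M ^ 2)"
    using search relabel unfolding pass_slots_def length_append list.size by linarith
  also have "\<dots> \<le> (12 * K + 5) * (n * M ^ 2)"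
    by (simp add: algebra_simps)
  finally show ?thesis
    by (simp add: M_def)
qed

lemma less_power_bits: "k < 2 ^ bits k"
proof (cases "k = 0")
  case False
  have "real k = 2 powr log 2 (real k)"
    using False by simp
  also have "\<dots> < 2 powr real (bits k)"
    using False by (intro powr_less_mono) (auto simp: bits_def, linarith)
  finally have "real k < real (2 ^ bits k)"
    by (simp add: powr_realpow)
  then show ?thesis
    by (simp only: of_nat_less_iff)
qed simp

lemma bits_le_log:
  assumes "k \<ge> 2"
  shows "real (bits k) \<le> 2 * log 2 (real k)" "real (2 ^ bits k) \<le> 2 * real k"
proof -
  have ge1: "log 2 (real k) \<ge> 1"
    using assms by (simp add: le_log_iff)
  have b: "real (bits k) \<le> 1 + log 2 (real k)"
    using ge1 by (simp add: bits_def)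
  show "real (bits k) \<le> 2 * log 2 (real k)"
    using b ge1 by linarith
  have "real (2 ^ bits k) = 2 powr real (bits k)"
    by (simp add: powr_realpow)
  also have "\<dots> \<le> 2 powr (1 + log 2 (real k))"
    using b by (intro powr_mono) auto
  also have "\<dots> = 2 * real k"
    using assms by (simp add: powr_add)
  finally show "real (2 ^ bits k) \<le> 2 * real k" .
qed

section \<open>Contracting the cluster graph\<close>

text \<open>The end of a chain of hooks. The guard demands a strict decrease, so the recursion
  terminates for every \<open>t\<close>, and a cluster hooking to itself is an end.\<close>

function hook_end :: "(nat \<Rightarrow> nat) \<Rightarrow> nat \<Rightarrow> nat" where
  "hook_end t r = (if t r < r then hook_end t (t r) else r)"
  by pat_completeness auto
termination by (relation "measure snd") auto

declare hook_end.simps [simp del]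

lemma hook_end_le: "hook_end t r \<le> r"
proof (induction r rule: less_induct)
  case (less r)
  show ?case
    using less.IH[of "t r"] by (subst hook_end.simps) auto
qed

lemma hook_end_0 [simp]: "hook_end t 0 = 0"
  using hook_end_le[of t 0] by simp

lemma hook_end_in:
  assumes "\<And>r. r \<in> R \<Longrightarrow> t r \<in> R" "r \<in> R"
  shows "hook_end t r \<in> R"
  using assms(2)
proof (induction r rule: less_induct)
  case (less r)
  show ?case
    using less assms(1) by (subst hook_end.simps) auto
qed

lemma hook_end_hook:
  assumes "t r \<le> r"
  shows "hook_end t (t r) = hook_end t r"
  using assms by (cases "t r = r") (auto simp: hook_end.simps[of t r])

lemma hook_end_fixed:
  assumes "\<And>r. r \<in> R \<Longrightarrow> t r \<in> R \<and> t r \<le> r" "r \<in> R"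
  shows "t (hook_end t r) = hook_end t r"
  using assms(2)
proof (induction r rule: less_induct)
  case (less r)
  show ?case
    using less assms(1)[of r] by (cases "t r < r") (auto simp: hook_end.simps[of t r])
qed

text \<open>All that the counting argument sees of a pass: keys hook at least as low as every
  adjacent key, and labels move to the ends of the chains. Trees, slots and messages are
  forgotten.\<close>

definition contracts :: "nat set \<Rightarrow> (nat \<Rightarrow> nat \<Rightarrow> bool) \<Rightarrow> (nat \<Rightarrow> nat) \<Rightarrow> (nat \<Rightarrow> nat) \<Rightarrow> bool" where
  "contracts V E f g \<longleftrightarrow> (\<exists>t. (\<forall>r\<in>f ` V. t r \<in> f ` V \<and> t r \<le> r) \<and>
     (\<forall>x y. E x y \<longrightarrow> t (f x) \<le> f y) \<and> (\<forall>v\<in>V. g v = hook_end t (f v)))"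

lemma contracts_subset:
  assumes "contracts V E f g"
  shows "g ` V \<subseteq> f ` V"
proof -
  obtain t where "\<forall>r\<in>f ` V. t r \<in> f ` V \<and> t r \<le> r" "\<forall>v\<in>V. g v = hook_end t (f v)"
    using assms by (auto simp: contracts_def)
  then show ?thesis
    using hook_end_in[of "f ` V" t] by fastforce
qed

lemma connected_crossing_edge:
  assumes "is_network V E" "x \<in> V" "y \<in> V" "P x" "\<not> P y"
  shows "\<exists>u v. E u v \<and> P u \<and> \<not> P v"
proof -
  have "E\<^sup>*\<^sup>* x y"
    using assms by (auto simp: is_network_def)
  then show ?thesis
    using assms(4,5) by (induction rule: rtranclp_induct) auto
qed

text \<open>One pass may leave almost all clusters in place (a star whose hub has the largest
  identifier). But if a cluster \<open>r\<close> attracts nobody, each of its neighbours moved to a cluster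
  smaller than \<open>r\<close>, so \<open>r\<close> itself is absorbed in the next pass.\<close>

lemma contracts_twice:
  assumes net: "is_network V E" and fg: "contracts V E f g" and gh: "contracts V E g h"
  shows "card (h ` V) = 1 \<or> 2 * card (h ` V) \<le> card (f ` V)"
proof (cases "card (h ` V) = 1")
  case False
  have fin: "finite V" "V \<noteq> {}" and E: "\<And>u v. E u v \<Longrightarrow> u \<in> V \<and> v \<in> V \<and> E v u"
    using net by (auto simp: is_network_def)
  obtain t where "(\<forall>r\<in>f ` V. t r \<in> f ` V \<and> t r \<le> r) \<and>
     (\<forall>x y. E x y \<longrightarrow> t (f x) \<le> f y) \<and> (\<forall>v\<in>V. g v = hook_end t (f v))"
    using fg unfolding contracts_def by (elim exE)
  then have t: "\<And>r. r \<in> f ` V \<Longrightarrow> t r \<in> f ` V \<and> t r \<le> r"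
    "\<And>x y. E x y \<Longrightarrow> t (f x) \<le> f y" "\<And>v. v \<in> V \<Longrightarrow> g v = hook_end t (f v)"
    by auto
  obtain t' where "(\<forall>r\<in>g ` V. t' r \<in> g ` V \<and> t' r \<le> r) \<and>
     (\<forall>x y. E x y \<longrightarrow> t' (g x) \<le> g y) \<and> (\<forall>v\<in>V. h v = hook_end t' (g v))"
    using gh unfolding contracts_def by (elim exE)
  then have t': "\<And>r. r \<in> g ` V \<Longrightarrow> t' r \<in> g ` V \<and> t' r \<le> r"
    "\<And>x y. E x y \<Longrightarrow> t' (g x) \<le> g y" "\<And>v. v \<in> V \<Longrightarrow> h v = hook_end t' (g v)"
    by auto
  \<comment> \<open>Each surviving key attracted another key in the earlier pass, so its fibre under
    \<open>hook_end t\<close> has at least two elements.\<close>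
  have two: "\<exists>r'\<in>f ` V. r' \<noteq> r \<and> hook_end t r' = r" if r: "r \<in> h ` V" for r
  proof (rule ccontr)
    assume none: "\<not> ?thesis"
    have rf: "r \<in> f ` V" and rg: "r \<in> g ` V"
      using r contracts_subset[OF fg] contracts_subset[OF gh] by blast+
    have t'r: "t' r = r"
    proof -
      obtain v where "v \<in> V" "r = hook_end t' (g v)"
        using r t'(3) by auto
      then show ?thesis
        using hook_end_fixed[of "g ` V" t' "g v"] t'(1) by auto
    qed
    have tr: "t r = r"
    proof -
      obtain v where "v \<in> V" "r = hook_end t (f v)"
        using rg t(3) by auto
      then show ?thesis
        using hook_end_fixed[of "f ` V" t "f v"] t(1) by auto
    qed
    have "\<exists>y\<in>V. f y \<noteq> r"
    proof (rule ccontr)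
      assume "\<not> ?thesis"
      then have "f ` V = {r}" using fin by auto
      then have "h ` V \<subseteq> {r}"
        using contracts_subset[OF fg] contracts_subset[OF gh] by auto
      then have "h ` V = {r}" using r by auto
      then show False using False by simp
    qed
    then obtain x y where xy: "E x y" "f x = r" "f y \<noteq> r"
      using connected_crossing_edge[OF net, of _ _ "\<lambda>v. f v = r"] rf by (metis image_iff)
    then have inV: "x \<in> V" "y \<in> V" and "E y x"
      using E by auto
    then have le: "t (f y) \<le> r"
      using t(2) xy by blast
    \<comment> \<open>A neighbour hooking directly to \<open>r\<close> would end there, because
      \<open>r\<close> is fixed by \<open>t\<close>; so it must hook strictly below
      \<open>r\<close>.\<close>
    have ne: "t (f y) \<noteq> r"
    proof
      assume "t (f y) = r"
      then have "hook_end t (f y) = r"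
        using hook_end_hook[of t "f y"] t(1)[of "f y"] inV hook_end.simps[of t r] tr by auto
      then show False
        using none inV xy by auto
    qed
    have "g y \<le> t (f y)"
      using hook_end_le[of t "t (f y)"] hook_end_hook[of t "f y"] t(1)[of "f y"] t(3) inV by auto
    then have "g y < r"
      using le ne by simp
    moreover have "g x = r"
      using t(3)[of x] inV xy tr hook_end.simps[of t r] by auto
    ultimately show False
      using t'(2)[OF xy(1)] t'r by simp
  qed
  have "2 * card (h ` V) = (\<Sum>r\<in>h ` V. 2)"
    by simp
  \<comment> \<open>The fibres are disjoint subsets of the old keys; each contains \<open>r\<close>
    itself and the key supplied by \<open>two\<close>.\<close>
  also have "\<dots> \<le> (\<Sum>r\<in>h ` V. card {r' \<in> f ` V. hook_end t r' = r})"
  proof (rule sum_mono)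
    fix r assume r: "r \<in> h ` V"
    obtain r' where r': "r' \<in> f ` V" "r' \<noteq> r" "hook_end t r' = r"
      using two[OF r] by auto
    have "r \<in> f ` V" "hook_end t r = r"
    proof -
      have rg: "r \<in> g ` V" using r contracts_subset[OF gh] by auto
      then show "r \<in> f ` V" using contracts_subset[OF fg] by auto
      obtain v where "v \<in> V" "r = hook_end t (f v)"
        using rg t(3) by auto
      then have "t r = r"
        using hook_end_fixed[of "f ` V" t "f v"] t(1) by auto
      then show "hook_end t r = r"
        by (simp add: hook_end.simps[of t r])
    qed
    then have "card {r, r'} \<le> card {r' \<in> f ` V. hook_end t r' = r}"
      using r' fin by (intro card_mono) auto
    then show "2 \<le> card {r' \<in> f ` V. hook_end t r' = r}"
      using r' by simp
  qed
  also have "\<dots> = card (\<Union>r\<in>h ` V. {r' \<in> f ` V. hook_end t r' = r})"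
    using fin by (intro card_UN_disjoint[symmetric]) auto
  also have "\<dots> \<le> card (f ` V)"
    using fin by (intro card_mono) auto
  finally show ?thesis by simp
qed simp

text \<open>A single remaining cluster is an absorbing case, since the sets of keys only shrink and
  never become empty.\<close>

lemma contracts_iterate:
  assumes "is_network V E" "\<And>i. i < 2 * k \<Longrightarrow> contracts V E (f i) (f (Suc i))"
  shows "card (f (2 * k) ` V) = 1 \<or> 2 ^ k * card (f (2 * k) ` V) \<le> card (f 0 ` V)"
  using assms(2)
proof (induction k)
  case (Suc k)
  have fin: "finite V" "V \<noteq> {}"
    using assms(1) by (auto simp: is_network_def)
  have c: "contracts V E (f (2 * k)) (f (Suc (2 * k)))"
    "contracts V E (f (Suc (2 * k))) (f (2 * Suc k))"
    using Suc.prems by auto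
  have sub: "f (2 * Suc k) ` V \<subseteq> f (2 * k) ` V"
    using contracts_subset[OF c(1)] contracts_subset[OF c(2)] by blast
  have pos: "card (f (2 * Suc k) ` V) \<ge> 1"
    using fin by (simp add: Suc_le_eq card_gt_0_iff)
  have le: "card (f (2 * Suc k) ` V) \<le> card (f (2 * k) ` V)"
    using fin sub by (intro card_mono) auto
  consider "card (f (2 * k) ` V) = 1" | "2 ^ k * card (f (2 * k) ` V) \<le> card (f 0 ` V)"
    using Suc by auto
  then show ?case
  proof cases
    case 1
    then show ?thesis using pos le by simp
  next
    case 2
    show ?thesis
    proof (cases "card (f (2 * Suc k) ` V) = 1")
      case False
      then have "2 * card (f (2 * Suc k) ` V) \<le> card (f (2 * k) ` V)"
        using contracts_twice[OF assms(1) c] by blast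
      then have "2 ^ k * (2 * card (f (2 * Suc k) ` V)) \<le> 2 ^ k * card (f (2 * k) ` V)"
        by (rule mult_le_mono2)
      then have "2 ^ Suc k * card (f (2 * Suc k) ` V) \<le> 2 ^ k * card (f (2 * k) ` V)"
        by (simp only: power_Suc mult_ac)
      then show ?thesis
        using 2 by (blast intro: order_trans)
    qed simp
  qed
qed simp

section \<open>Cluster forests and the search for the smallest neighbouring cluster\<close>

text \<open>No element has a prefix below \<open>2 * c\<close>, as dropping one more bit would
  undercut the minimum. Hence the next bit is 0 exactly when some element has prefix
  \<open>2 * c\<close>, a question answered by one disjunction.\<close>

lemma binary_search_step:
  fixes S :: "nat set"
  assumes "finite S" "S \<noteq> {}" "c = Min S div 2 ^ Suc b"
  shows "Min S div 2 ^ b = (if \<exists>k\<in>S. k div 2 ^ b = 2 * c then 2 * c else Suc (2 * c))"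
proof -
  have half: "x div 2 ^ Suc b = x div 2 ^ b div 2" for x :: nat
    using div_mult2_eq[of x "2 ^ b" 2] by (simp only: power_Suc mult.commute)
  have low: "2 * c \<le> k div 2 ^ b" if "k \<in> S" for k
  proof -
    have "Min S div 2 ^ Suc b \<le> k div 2 ^ Suc b"
      using that assms(1) by (intro div_le_mono) simp
    then show ?thesis
      using assms(3) half[of k] by linarith
  qed
  have mem: "Min S \<in> S"
    using assms by simp
  show ?thesis
  proof (cases "\<exists>k\<in>S. k div 2 ^ b = 2 * c")
    case True
    then obtain k where k: "k \<in> S" "k div 2 ^ b = 2 * c" by auto
    have "Min S div 2 ^ b \<le> k div 2 ^ b"
      using k assms(1) by (intro div_le_mono) simp
    then show ?thesis
      using low[OF mem] k True by simp
  next
    case False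
    then have "Min S div 2 ^ b \<noteq> 2 * c"
      using mem by blast
    then show ?thesis
      using False low[OF mem] assms(3) half[of "Min S"] by simp
  qed
qed

text \<open>If \<open>K \<le> b\<close>, the listener's identifier lies wholly below bit
  \<open>b\<close> and disappears. Otherwise \<open>k * 2 ^ K\<close> is a multiple of
  \<open>2 ^ b\<close>, so only the identifier is truncated.\<close>

lemma probe_val_div:
  assumes "v < 2 ^ K"
  shows "probe_val K b (k div 2 ^ (b - K)) v = (k * 2 ^ K + v) div 2 ^ b"
proof (cases "K \<le> b")
  case True
  then have "(2::nat) ^ b = 2 ^ K * 2 ^ (b - K)"
    by (simp flip: power_add)
  then show ?thesis
    using assms True by (simp add: probe_val_def div_mult2_eq)
next
  case False
  then have "(2::nat) ^ K = 2 ^ (K - b) * 2 ^ b"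
    by (simp flip: power_add)
  then have "k * 2 ^ K + v = v + (k * 2 ^ (K - b)) * 2 ^ b"
    by (simp only: mult.assoc add.commute)
  moreover have "(v + (k * 2 ^ (K - b)) * 2 ^ b) div 2 ^ b = k * 2 ^ (K - b) + v div 2 ^ b"
    by (rule div_mult_self1) simp
  ultimately show ?thesis
    using False by (simp only: probe_val_def if_False not_le) simp
qed

lemma probe_val_inj: "probe_val K b q v = probe_val K b q' v \<Longrightarrow> q = q'"
  by (auto simp: probe_val_def split: if_splits)

section \<open>Rooted cluster forests\<close>

locale radio_network =
  fixes V :: "nat set" and E :: "nat \<Rightarrow> nat \<Rightarrow> bool" and s :: nat and m :: 'm and K n :: nat
  assumes network: "is_network V E"
    and ids: "V \<subseteq> {0<..<2 ^ K}"
    and card_V: "card V = n"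
    and source: "s \<in> V"
begin

abbreviation "stp \<equiv> step K V E"
abbreviation "rn \<equiv> run K V E"

lemma finite_V: "finite V"
  and edgeD: "E u v \<Longrightarrow> u \<in> V" "E u v \<Longrightarrow> v \<in> V" "E u v \<Longrightarrow> u \<noteq> v" "E u v \<Longrightarrow> E v u"
  using network by (auto simp: is_network_def)

lemma id_bounds: "v \<in> V \<Longrightarrow> 0 < v" "v \<in> V \<Longrightarrow> v < 2 ^ K"
  using ids by auto

definition key :: "nat \<Rightarrow> nat" where
  "key v = (if v = s then 0 else v)"

lemma key_inj: "u \<in> V \<Longrightarrow> v \<in> V \<Longrightarrow> key u = key v \<Longrightarrow> u = v"
  using id_bounds(1) by (auto simp: key_def split: if_splits)

lemma key_less: "v \<in> V \<Longrightarrow> key v < 2 ^ K"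
  using id_bounds(2) by (auto simp: key_def)

text \<open>A purely local condition: strictly decreasing depth excludes cycles, and since a vertex
  of depth 0 is labelled by its own key, injectivity of \<open>key\<close> leaves one root per
  cluster.\<close>

definition forest :: "(nat \<Rightarrow> nat) \<Rightarrow> (nat \<Rightarrow> nat) \<Rightarrow> (nat \<Rightarrow> nat) \<Rightarrow> bool" where
  "forest \<rho> \<delta> \<pi> \<longleftrightarrow> (\<forall>v\<in>V. \<delta> v = 0 \<and> \<rho> v = key v \<or>
     \<delta> v \<noteq> 0 \<and> E v (\<pi> v) \<and> \<delta> v = Suc (\<delta> (\<pi> v)) \<and> \<rho> v = \<rho> (\<pi> v))"

lemma forestD:
  assumes "forest \<rho> \<delta> \<pi>" "v \<in> V"
  shows "\<delta> v = 0 \<and> \<rho> v = key v \<or>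
     \<delta> v \<noteq> 0 \<and> E v (\<pi> v) \<and> \<delta> v = Suc (\<delta> (\<pi> v)) \<and> \<rho> v = \<rho> (\<pi> v)"
  using assms unfolding forest_def by (rule bspec)

lemma forest_parent:
  assumes "forest \<rho> \<delta> \<pi>" "v \<in> V" "\<delta> v = Suc d"
  shows "\<pi> v \<in> V" "E v (\<pi> v)" "\<delta> (\<pi> v) = d" "\<rho> (\<pi> v) = \<rho> v"
proof -
  have "E v (\<pi> v) \<and> \<delta> v = Suc (\<delta> (\<pi> v)) \<and> \<rho> v = \<rho> (\<pi> v)"
    using forestD[OF assms(1,2)] assms(3) by (elim disjE) simp_all
  then show "\<pi> v \<in> V" "E v (\<pi> v)" "\<delta> (\<pi> v) = d" "\<rho> (\<pi> v) = \<rho> v"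
    using assms(3) edgeD(2) by auto
qed

text \<open>The path to the root meets every smaller depth. The depths in use thus form an initial
  segment, which bounds them by the number of vertices and justifies \<open>n\<close> levels of
  slots.\<close>

lemma forest_depth_image:
  assumes "forest \<rho> \<delta> \<pi>" "v \<in> V"
  shows "{0..\<delta> v} \<subseteq> \<delta> ` V"
  using assms(2)
proof (induction "\<delta> v" arbitrary: v)
  case 0
  then show ?case by force
next
  case (Suc d)
  have "{0..d} \<subseteq> \<delta> ` V"
    using Suc.hyps(1)[of "\<pi> v"] forest_parent[OF assms(1) Suc.prems, of d] Suc.hyps(2) by simp
  moreover have "Suc d \<in> \<delta> ` V"
    using Suc by auto
  ultimately show ?case
    by (simp flip: Suc.hyps(2) add: atLeast0_atMost_Suc)
qed

lemma forest_depth_less: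
  assumes "forest \<rho> \<delta> \<pi>" "v \<in> V"
  shows "\<delta> v < n"
proof -
  have "card {0..\<delta> v} \<le> card (\<delta> ` V)"
    using forest_depth_image[OF assms] finite_V by (intro card_mono) auto
  also have "\<dots> \<le> n"
    using card_image_le[OF finite_V] card_V by simp
  finally show ?thesis by simp
qed

lemma forest_root:
  assumes "forest \<rho> \<delta> \<pi>" "v \<in> V"
  shows "\<exists>x\<in>V. \<delta> x = 0 \<and> \<rho> x = \<rho> v \<and> key x = \<rho> v"
  using assms(2)
proof (induction "\<delta> v" arbitrary: v)
  case 0
  then show ?case
    using forestD[OF assms(1) 0(2)] by auto
next
  case (Suc d)
  have "\<pi> v \<in> V" "\<delta> (\<pi> v) = d" "\<rho> (\<pi> v) = \<rho> v"
    using forest_parent[OF assms(1) Suc.prems] Suc.hyps(2) by metis+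
  then show ?case
    using Suc.hyps(1)[of "\<pi> v"] by simp
qed

lemma forest_root_unique:
  assumes "forest \<rho> \<delta> \<pi>" "u \<in> V" "v \<in> V" "\<rho> u = \<rho> v" "\<delta> u = 0" "\<delta> v = 0"
  shows "u = v"
  using forestD[OF assms(1,2)] forestD[OF assms(1,3)] assms(2-) key_inj[of u v] by auto

lemma forest_root_less: "forest \<rho> \<delta> \<pi> \<Longrightarrow> v \<in> V \<Longrightarrow> \<rho> v < 2 ^ K"
  using forest_root key_less by metis

section \<open>Combining a bit over each cluster\<close>

abbreviation (input) "rootf \<sigma> \<equiv> (\<lambda>v. root (\<sigma> v))"
abbreviation (input) "depf \<sigma> \<equiv> (\<lambda>v. dep (\<sigma> v))"
abbreviation (input) "parf \<sigma> \<equiv> (\<lambda>v. par (\<sigma> v))"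

text \<open>Within a search level only flags change. Writing states in this form turns the effect of
  a slot block into an update of a Boolean function.\<close>

definition with_flags :: "(nat \<Rightarrow> 'm st) \<Rightarrow> (nat \<Rightarrow> bool) \<Rightarrow> nat \<Rightarrow> 'm st" where
  "with_flags \<sigma> f = (\<lambda>v. (\<sigma> v)\<lparr>flag := f v\<rparr>)"

lemma with_flags_simps [simp]:
  "root (with_flags \<sigma> f v) = root (\<sigma> v)" "dep (with_flags \<sigma> f v) = dep (\<sigma> v)"
  "par (with_flags \<sigma> f v) = par (\<sigma> v)" "cur (with_flags \<sigma> f v) = cur (\<sigma> v)"
  "flag (with_flags \<sigma> f v) = f v"
  by (simp_all add: with_flags_def)

lemma with_flags_eqI: "(\<And>v. f v = g v) \<Longrightarrow> with_flags \<sigma> f = with_flags \<sigma> g"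
  by (simp add: with_flags_def)

lemma step_Up:
  "stp (Up d p) (with_flags \<sigma> f) = with_flags \<sigma> (\<lambda>v. f v \<or>
     v = p \<and> Suc (dep (\<sigma> v)) = d \<and> (\<exists>u. E v u \<and> dep (\<sigma> u) = d \<and> par (\<sigma> u) = v \<and> f u))"
proof -
  define P where "P v \<longleftrightarrow> (\<exists>u. E v u \<and> dep (\<sigma> u) = d \<and> par (\<sigma> u) = v \<and> f u)" for v
  have "stp (Up d p) (with_flags \<sigma> f) v
      = with_flags \<sigma> (\<lambda>v. f v \<or> v = p \<and> Suc (dep (\<sigma> v)) = d \<and> P v) v" for v
  proof (cases "v = p \<and> Suc (dep (\<sigma> v)) = d")
    case True
    have "cd_feedback V E (\<lambda>u. emit K u (Up d p) (with_flags \<sigma> f u)) v \<noteq> Silence \<longleftrightarrow> P v"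
      unfolding cd_feedback_silence_iff P_def using True by (auto dest: edgeD)
    then have "stp (Up d p) (with_flags \<sigma> f) v
        = (if P v then (with_flags \<sigma> f v)\<lparr>flag := True\<rparr> else with_flags \<sigma> f v)"
      using conjunct2[OF True] conjunct1[OF True]
      by (simp only: step_def upd.simps with_flags_simps simp_thms)
    then show ?thesis
      using True by (cases "P v") (auto simp: with_flags_def)
  next
    case False
    then have "(f v \<or> v = p \<and> Suc (dep (\<sigma> v)) = d \<and> P v) \<longleftrightarrow> f v"
      by blast
    moreover have "stp (Up d p) (with_flags \<sigma> f) v = with_flags \<sigma> f v"
      using False by (auto simp: step_def)
    ultimately show ?thesis
      by (simp only: with_flags_def)
  qed
  then show ?thesis
    unfolding P_def by (rule ext)
qed

lemma step_Down:
  "stp (Down d p) (with_flags \<sigma> f) = with_flags \<sigma> (\<lambda>v.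
     if par (\<sigma> v) = p \<and> dep (\<sigma> v) = Suc d then E v p \<and> dep (\<sigma> p) = d \<and> f p else f v)"
proof (rule ext)
  fix v
  show "stp (Down d p) (with_flags \<sigma> f) v = with_flags \<sigma> (\<lambda>v.
     if par (\<sigma> v) = p \<and> dep (\<sigma> v) = Suc d then E v p \<and> dep (\<sigma> p) = d \<and> f p else f v) v"
  proof (cases "par (\<sigma> v) = p \<and> dep (\<sigma> v) = Suc d")
    case True
    have "cd_feedback V E (\<lambda>u. emit K u (Down d p) (with_flags \<sigma> f u)) v \<noteq> Silence \<longleftrightarrow>
      E v p \<and> dep (\<sigma> p) = d \<and> f p"
      unfolding cd_feedback_silence_iff using True by (auto dest: edgeD intro!: bexI[of _ p])
    then show ?thesis
      using True by (simp add: step_def with_flags_def)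
  qed (auto simp: step_def with_flags_def)
qed

lemma step_Probe:
  "stp (Probe b q) (with_flags \<sigma> f) = with_flags \<sigma> (\<lambda>v.
     if probe_val K b q v = 2 * cur (\<sigma> v)
     then \<exists>w. (w = v \<or> E v w) \<and> (root (\<sigma> w) * 2 ^ K + w) div 2 ^ (b - K) = q else f v)"
proof (rule ext)
  fix v
  show "stp (Probe b q) (with_flags \<sigma> f) v = with_flags \<sigma> (\<lambda>v.
     if probe_val K b q v = 2 * cur (\<sigma> v)
     then \<exists>w. (w = v \<or> E v w) \<and> (root (\<sigma> w) * 2 ^ K + w) div 2 ^ (b - K) = q else f v) v"
  proof (cases "probe_val K b q v = 2 * cur (\<sigma> v)")
    case True
    have "cd_feedback V E (\<lambda>u. emit K u (Probe b q) (with_flags \<sigma> f u)) v \<noteq> Silence \<longleftrightarrow>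
      (\<exists>w. (w = v \<or> E v w) \<and> (root (\<sigma> w) * 2 ^ K + w) div 2 ^ (b - K) = q)"
      unfolding cd_feedback_silence_iff using True by (auto dest: edgeD)
    then show ?thesis
      using True by (simp add: step_def with_flags_def)
  qed (simp add: step_def with_flags_def)
qed

text \<open>Slots of one depth do not interfere: senders sit at depth \<open>d\<close>, while flags
  change only one level above. The sequence acts like a simultaneous update. The same separation
  holds for \<open>run_Down\<close>.\<close>

lemma run_Up:
  "rn (map (Up d) [0..<M]) (with_flags \<sigma> f) = with_flags \<sigma> (\<lambda>v. f v \<or>
     v < M \<and> Suc (dep (\<sigma> v)) = d \<and> (\<exists>u. E v u \<and> dep (\<sigma> u) = d \<and> par (\<sigma> u) = v \<and> f u))"
proof (induction M)
  case (Suc M)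
  show ?case
    unfolding upt_Suc_append[OF le0] map_append run_simps Suc list.map step_Up
    by (rule with_flags_eqI) (auto simp: less_Suc_eq)
qed simp

lemma run_Down:
  "rn (map (Down d) [0..<M]) (with_flags \<sigma> f) = with_flags \<sigma> (\<lambda>v.
     if par (\<sigma> v) < M \<and> dep (\<sigma> v) = Suc d
     then E v (par (\<sigma> v)) \<and> dep (\<sigma> (par (\<sigma> v))) = d \<and> f (par (\<sigma> v)) else f v)"
proof (induction M)
  case (Suc M)
  show ?case
    unfolding upt_Suc_append[OF le0] map_append run_simps Suc list.map step_Down
    by (rule with_flags_eqI) (auto simp: less_Suc_eq)
qed simp

text \<open>By \<open>probe_val_inj\<close> each vertex tests in at most one of these slots, so no
  test result is overwritten by a later one.\<close>

lemma run_Probe: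
  "rn (map (Probe b) [0..<M]) (with_flags \<sigma> f) = with_flags \<sigma> (\<lambda>v.
     if \<exists>q<M. probe_val K b q v = 2 * cur (\<sigma> v)
     then \<exists>w. (w = v \<or> E v w) \<and> (root (\<sigma> w) * 2 ^ K + w) div 2 ^ (b - K) < M \<and>
       probe_val K b ((root (\<sigma> w) * 2 ^ K + w) div 2 ^ (b - K)) v = 2 * cur (\<sigma> v) else f v)"
proof (induction M)
  case (Suc M)
  show ?case
    unfolding upt_Suc_append[OF le0] map_append run_simps Suc list.map step_Probe
  proof (rule with_flags_eqI, goal_cases)
    case (1 v)
    show ?case
    proof (cases "probe_val K b M v = 2 * cur (\<sigma> v)")
      case True
      then have "probe_val K b q v = 2 * cur (\<sigma> v) \<longleftrightarrow> q = M" for q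
        using probe_val_inj by metis
      then show ?thesis by auto
    next
      case False
      then show ?thesis
        by (auto simp: less_Suc_eq)
    qed
  qed
qed simp

text \<open>Invariant of the upward sweep: once all levels deeper than \<open>j\<close> have
  reported, the flags at depth at most \<open>j\<close> carry the disjunction of the whole cluster.
  At the start the claim is trivial for \<open>n \<le> Suc j\<close>, since all depths are below
  \<open>n\<close>.\<close>

lemma up_phases:
  fixes \<sigma> :: "nat \<Rightarrow> 'm st"
  assumes F: "forest (rootf \<sigma>) (depf \<sigma>) (parf \<sigma>)"
  shows "\<exists>g. rn (grid Up (rev [Suc j..<n]) (2 ^ K)) (with_flags \<sigma> f) = with_flags \<sigma> g \<and>
    (\<forall>v\<in>V. (\<exists>w\<in>V. root (\<sigma> w) = root (\<sigma> v) \<and> dep (\<sigma> w) \<le> j \<and> g w) \<longleftrightarrow>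
       (\<exists>w\<in>V. root (\<sigma> w) = root (\<sigma> v) \<and> f w))"
proof (induction "n - Suc j" arbitrary: j)
  case 0
  then show ?case
    using forest_depth_less[OF F] by (intro exI[of _ f]) (fastforce simp: grid_def)
next
  case (Suc k)
  obtain g where g: "rn (grid Up (rev [Suc (Suc j)..<n]) (2 ^ K)) (with_flags \<sigma> f) = with_flags \<sigma> g"
    "\<And>v. v \<in> V \<Longrightarrow> (\<exists>w\<in>V. root (\<sigma> w) = root (\<sigma> v) \<and> dep (\<sigma> w) \<le> Suc j \<and> g w) \<longleftrightarrow>
       (\<exists>w\<in>V. root (\<sigma> w) = root (\<sigma> v) \<and> f w)"
  proof -
    have "k = n - Suc (Suc j)"
      using Suc.hyps(2) by simp
    from Suc.hyps(1)[OF this] show thesis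
      using that by blast
  qed
  define g' where "g' = (\<lambda>v. g v \<or> v < 2 ^ K \<and> Suc (dep (\<sigma> v)) = Suc j \<and>
    (\<exists>u. E v u \<and> dep (\<sigma> u) = Suc j \<and> par (\<sigma> u) = v \<and> g u))"
  have "[Suc j..<n] = Suc j # [Suc (Suc j)..<n]"
    using Suc.hyps(2) by (simp add: upt_conv_Cons)
  then have "rn (grid Up (rev [Suc j..<n]) (2 ^ K)) (with_flags \<sigma> f) = with_flags \<sigma> g'"
    using g(1) by (simp add: grid_def run_Up g'_def)
  moreover have "(\<exists>w\<in>V. root (\<sigma> w) = root (\<sigma> v) \<and> dep (\<sigma> w) \<le> j \<and> g' w) \<longleftrightarrow>
       (\<exists>w\<in>V. root (\<sigma> w) = root (\<sigma> v) \<and> dep (\<sigma> w) \<le> Suc j \<and> g w)" (is "?L \<longleftrightarrow> ?R") for v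
  proof
    assume ?L
    then obtain w where w: "w \<in> V" "root (\<sigma> w) = root (\<sigma> v)" "dep (\<sigma> w) \<le> j" "g' w"
      by auto
    show ?R
    proof (cases "g w")
      case True
      then show ?thesis using w by auto
    next
      case False
      then obtain u where u: "E w u" "dep (\<sigma> u) = Suc j" "par (\<sigma> u) = w" "g u"
        using w(4) by (auto simp: g'_def)
      then have "root (\<sigma> u) = root (\<sigma> w)"
        using forest_parent(4)[OF F, of u j] edgeD by auto
      then show ?thesis
        using u w edgeD by (intro bexI[of _ u]) auto
    qed
  next
    assume ?R
    then obtain w where w: "w \<in> V" "root (\<sigma> w) = root (\<sigma> v)" "dep (\<sigma> w) \<le> Suc j" "g w"
      by auto
    show ?L
    proof (cases "dep (\<sigma> w) = Suc j")
      case True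
      note p = forest_parent[OF F w(1) True]
      have "g' (par (\<sigma> w))"
        using p w True edgeD(4) id_bounds(2)[OF p(1)] unfolding g'_def by blast
      then show ?thesis
        using p w by (intro bexI[of _ "par (\<sigma> w)"]) auto
    next
      case False
      then show ?thesis
        using w by (intro bexI[of _ w]) (auto simp: g'_def)
    qed
  qed
  ultimately show ?case
    by (intro exI[of _ g'] conjI ballI) (simp_all add: g(2))
qed

text \<open>A child replaces its flag by that of its parent rather than adding to it. Leftovers of
  the upward sweep vanish and the value depends only on the cluster.\<close>

lemma down_phases:
  fixes \<sigma> :: "nat \<Rightarrow> 'm st"
  assumes F: "forest (rootf \<sigma>) (depf \<sigma>) (parf \<sigma>)"
    and f: "\<And>v. v \<in> V \<Longrightarrow> dep (\<sigma> v) = 0 \<Longrightarrow> f v \<longleftrightarrow> Q (root (\<sigma> v))"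
  shows "\<exists>g. rn (grid Down [0..<j] (2 ^ K)) (with_flags \<sigma> f) = with_flags \<sigma> g \<and>
    (\<forall>v\<in>V. dep (\<sigma> v) \<le> j \<longrightarrow> (g v \<longleftrightarrow> Q (root (\<sigma> v))))"
proof (induction j)
  case 0
  then show ?case
    using f by (intro exI[of _ f]) (simp add: grid_def)
next
  case (Suc j)
  then obtain g where g: "rn (grid Down [0..<j] (2 ^ K)) (with_flags \<sigma> f) = with_flags \<sigma> g"
    "\<And>v. v \<in> V \<Longrightarrow> dep (\<sigma> v) \<le> j \<Longrightarrow> g v \<longleftrightarrow> Q (root (\<sigma> v))"
    by auto
  define g' where "g' = (\<lambda>v. if par (\<sigma> v) < 2 ^ K \<and> dep (\<sigma> v) = Suc j
     then E v (par (\<sigma> v)) \<and> dep (\<sigma> (par (\<sigma> v))) = j \<and> g (par (\<sigma> v)) else g v)"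
  have "rn (grid Down [0..<Suc j] (2 ^ K)) (with_flags \<sigma> f) = with_flags \<sigma> g'"
    using g(1) by (simp add: grid_def run_Down g'_def)
  moreover have "g' v \<longleftrightarrow> Q (root (\<sigma> v))" if "v \<in> V" "dep (\<sigma> v) \<le> Suc j" for v
  proof (cases "dep (\<sigma> v) = Suc j")
    case True
    note p = forest_parent[OF F that(1) True]
    show ?thesis
      using p True id_bounds(2)[OF p(1)] g(2)[OF p(1)] by (simp add: g'_def)
  next
    case False
    then show ?thesis
      using that g(2)[of v] by (simp add: g'_def)
  qed
  ultimately show ?case by blast
qed

lemma cast_phases:
  fixes \<sigma> :: "nat \<Rightarrow> 'm st"
  assumes F: "forest (rootf \<sigma>) (depf \<sigma>) (parf \<sigma>)"
  shows "\<exists>g. rn (cast_slots K n) (with_flags \<sigma> f) = with_flags \<sigma> g \<and>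
    (\<forall>v\<in>V. g v \<longleftrightarrow> (\<exists>w\<in>V. root (\<sigma> w) = root (\<sigma> v) \<and> f w))"
proof -
  obtain g where g: "rn (grid Up (rev [1..<n]) (2 ^ K)) (with_flags \<sigma> f) = with_flags \<sigma> g"
    "\<And>v. v \<in> V \<Longrightarrow> (\<exists>w\<in>V. root (\<sigma> w) = root (\<sigma> v) \<and> dep (\<sigma> w) \<le> 0 \<and> g w) \<longleftrightarrow>
       (\<exists>w\<in>V. root (\<sigma> w) = root (\<sigma> v) \<and> f w)"
    using up_phases[OF F, of 0 f] by auto
  define Q where "Q r \<longleftrightarrow> (\<exists>w\<in>V. root (\<sigma> w) = r \<and> f w)" for r
  \<comment> \<open>At depth 0 the cluster has a single vertex, so the existential in
    \<open>g(2)\<close> collapses to the root's own flag.\<close>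
  have "g v \<longleftrightarrow> Q (root (\<sigma> v))" if "v \<in> V" "dep (\<sigma> v) = 0" for v
    using g(2)[OF that(1)] forest_root_unique[OF F _ that(1)] that unfolding Q_def by fastforce
  then have "\<exists>g'. rn (grid Down [0..<n] (2 ^ K)) (with_flags \<sigma> g) = with_flags \<sigma> g' \<and>
    (\<forall>v\<in>V. dep (\<sigma> v) \<le> n \<longrightarrow> (g' v \<longleftrightarrow> Q (root (\<sigma> v))))"
    by (intro down_phases F)
  then obtain g' where
    "rn (grid Down [0..<n] (2 ^ K)) (with_flags \<sigma> g) = with_flags \<sigma> g'"
    "\<And>v. v \<in> V \<Longrightarrow> dep (\<sigma> v) \<le> n \<Longrightarrow> g' v \<longleftrightarrow> Q (root (\<sigma> v))"
    by auto
  then show ?thesis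
    using g(1) forest_depth_less[OF F] by (intro exI[of _ g']) (auto simp: cast_slots_def Q_def less_imp_le)
qed

text \<open>The links by which the cluster \<open>r\<close> can hook, encoded so that the smallest code has the
  smallest neighbouring root. Links from a vertex to itself are included; hence a cluster that
  has no smaller neighbour hooks to itself.\<close>

definition links :: "(nat \<Rightarrow> nat) \<Rightarrow> nat \<Rightarrow> nat set" where
  "links \<rho> r = {(\<rho> w * 2 ^ K + w) * 2 ^ K + u |u w. u \<in> V \<and> \<rho> u = r \<and> (w = u \<or> E u w)}"

lemma finite_links: "finite (links \<rho> r)"
proof -
  have "links \<rho> r \<subseteq> (\<lambda>(u, w). (\<rho> w * 2 ^ K + w) * 2 ^ K + u) ` (V \<times> V)"
    using edgeD by (fastforce simp: links_def)
  then show ?thesis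
    using finite_V finite_subset by blast
qed

lemma links_less:
  assumes F: "forest \<rho> \<delta> \<pi>" and "c \<in> links \<rho> r"
  shows "c < 2 ^ (3 * K)"
proof -
  obtain u w where uw: "c = (\<rho> w * 2 ^ K + w) * 2 ^ K + u" "u \<in> V" "w \<in> V"
    using assms(2) edgeD unfolding links_def by blast
  have "\<rho> w + 1 \<le> 2 ^ K" "w + 1 \<le> 2 ^ K" "u + 1 \<le> 2 ^ K"
    using forest_root_less[OF F uw(3)] id_bounds uw by (auto simp: Suc_le_eq)
  then have "(\<rho> w + 1) * 2 ^ K \<le> 2 ^ K * 2 ^ K"
    by (intro mult_right_mono) auto
  then have "\<rho> w * 2 ^ K + w + 1 \<le> 2 ^ K * 2 ^ K"
    using \<open>w + 1 \<le> 2 ^ K\<close> by (simp add: algebra_simps)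
  then have "(\<rho> w * 2 ^ K + w + 1) * 2 ^ K \<le> 2 ^ K * 2 ^ K * 2 ^ K"
    by (rule mult_right_mono) simp
  then have "c + 1 \<le> 2 ^ K * 2 ^ K * 2 ^ K"
    using \<open>u + 1 \<le> 2 ^ K\<close> by (simp add: uw(1) algebra_simps)
  also have "\<dots> = 2 ^ (3 * K)"
    by (simp flip: power_add)
  finally show ?thesis by simp
qed

lemma level_phases:
  fixes \<sigma> :: "nat \<Rightarrow> 'm st"
  assumes F: "forest (rootf \<sigma>) (depf \<sigma>) (parf \<sigma>)"
    and cur: "\<And>v. v \<in> V \<Longrightarrow> cur (\<sigma> v) = Min (links (rootf \<sigma>) (root (\<sigma> v))) div 2 ^ Suc b"
    and flag: "\<And>v. \<not> flag (\<sigma> v)"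
  shows "\<exists>c. rn (level_slots K n b @ [Shift]) \<sigma> = (\<lambda>v. (\<sigma> v)\<lparr>cur := c v\<rparr>) \<and>
    (\<forall>v\<in>V. c v = Min (links (rootf \<sigma>) (root (\<sigma> v))) div 2 ^ b)"
proof -
  define L where "L v = links (rootf \<sigma>) (root (\<sigma> v))" for v
  define f where "f = (\<lambda>v. if \<exists>q<2 ^ K * 2 ^ K. probe_val K b q v = 2 * cur (\<sigma> v)
     then \<exists>w. (w = v \<or> E v w) \<and> (root (\<sigma> w) * 2 ^ K + w) div 2 ^ (b - K) < 2 ^ K * 2 ^ K \<and>
       probe_val K b ((root (\<sigma> w) * 2 ^ K + w) div 2 ^ (b - K)) v = 2 * cur (\<sigma> v) else False)"
  have "\<sigma> = with_flags \<sigma> (\<lambda>_. False)"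
    using flag by (auto simp: with_flags_def)
  then have 1: "rn (map (Probe b) [0..<2 ^ K * 2 ^ K]) \<sigma> = with_flags \<sigma> f"
    unfolding f_def using run_Probe[of b "2 ^ K * 2 ^ K" \<sigma> "\<lambda>_. False"] by simp
  \<comment> \<open>All codes of actual senders fall into the \<open>2 ^ K * 2 ^ K\<close> available
    slots, so the range condition in \<open>f\<close> excludes nobody.\<close>
  have small: "(root (\<sigma> w) * 2 ^ K + w) div 2 ^ (b - K) < 2 ^ K * 2 ^ K" if "w \<in> V" for w
  proof -
    have "(root (\<sigma> w) * 2 ^ K + w) div 2 ^ (b - K) \<le> root (\<sigma> w) * 2 ^ K + w"
      by simp
    also have "\<dots> < (root (\<sigma> w) + 1) * 2 ^ K"
      using id_bounds(2)[OF that] by simp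
    also have "\<dots> \<le> 2 ^ K * 2 ^ K"
      using forest_root_less[OF F that] by (intro mult_right_mono) auto
    finally show ?thesis .
  qed
  have f: "f v \<longleftrightarrow> (\<exists>w. (w = v \<or> E v w) \<and>
      ((root (\<sigma> w) * 2 ^ K + w) * 2 ^ K + v) div 2 ^ b = 2 * cur (\<sigma> v))" if v: "v \<in> V" for v
  proof -
    have "f v \<longleftrightarrow> (\<exists>w. (w = v \<or> E v w) \<and> 
       probe_val K b ((root (\<sigma> w) * 2 ^ K + w) div 2 ^ (b - K)) v = 2 * cur (\<sigma> v))"
      unfolding f_def using small v edgeD(2) by auto
    then show ?thesis
      using probe_val_div[OF id_bounds(2)[OF v]] by simp
  qed
  obtain g where g: "rn (cast_slots K n) (with_flags \<sigma> f) = with_flags \<sigma> g"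
    "\<And>v. v \<in> V \<Longrightarrow> g v \<longleftrightarrow> (\<exists>w\<in>V. root (\<sigma> w) = root (\<sigma> v) \<and> f w)"
  proof -
    from cast_phases[OF F, of f] show thesis
      using that by blast
  qed
  have 2: "rn (level_slots K n b @ [Shift]) \<sigma>
      = (\<lambda>v. (\<sigma> v)\<lparr>cur := (if g v then 2 * cur (\<sigma> v) else Suc (2 * cur (\<sigma> v)))\<rparr>)"
  proof (rule ext)
    fix v
    \<comment> \<open>\<open>Shift\<close> clears the flags, which were clear before the level; so
      only \<open>cur\<close> differs, and the next level starts from clear flags as well.\<close>
    have "(\<sigma> v)\<lparr>cur := x, flag := False\<rparr> = (\<sigma> v)\<lparr>cur := x\<rparr>" for x
      using flag[of v] by (cases "\<sigma> v") simp
    then show "rn (level_slots K n b @ [Shift]) \<sigma> v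
      = (\<sigma> v)\<lparr>cur := (if g v then 2 * cur (\<sigma> v) else Suc (2 * cur (\<sigma> v)))\<rparr>"
      by (simp add: level_slots_def 1 g(1) step_def) (simp add: with_flags_def)
  qed
  have "(if g v then 2 * cur (\<sigma> v) else Suc (2 * cur (\<sigma> v))) = Min (L v) div 2 ^ b"
    if v: "v \<in> V" for v
  proof -
    \<comment> \<open>All members of a cluster hold the same prefix, so their individual tests ask
      the same question and may be combined by a disjunction.\<close>
    have same: "cur (\<sigma> u) = cur (\<sigma> v)" if "u \<in> V" "root (\<sigma> u) = root (\<sigma> v)" for u
      by (simp only: cur[OF that(1)] cur[OF v] that(2))
    have "g v \<longleftrightarrow> (\<exists>k\<in>L v. k div 2 ^ b = 2 * cur (\<sigma> v))"
    proof -
      have "g v \<longleftrightarrow> (\<exists>u\<in>V. root (\<sigma> u) = root (\<sigma> v) \<and> (\<exists>w. (w = u \<or> E u w) \<and>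
        ((root (\<sigma> w) * 2 ^ K + w) * 2 ^ K + u) div 2 ^ b = 2 * cur (\<sigma> v)))"
        unfolding g(2)[OF v] by (intro bex_cong refl conj_cong) (simp add: f same)
      then show ?thesis
        unfolding L_def links_def by blast
    qed
    moreover have "L v \<noteq> {}"
      using v unfolding L_def links_def by blast
    ultimately show ?thesis
      using binary_search_step[of "L v" "cur (\<sigma> v)" b] cur[OF v] finite_links
      by (simp add: L_def)
  qed
  then show ?thesis
    unfolding 2 L_def
    by (intro exI[of _ "\<lambda>v. if g v then 2 * cur (\<sigma> v) else Suc (2 * cur (\<sigma> v))"]) simp
qed

lemma search_phases:
  fixes \<sigma> :: "nat \<Rightarrow> 'm st"
  assumes F: "forest (rootf \<sigma>) (depf \<sigma>) (parf \<sigma>)"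
    and init: "\<And>v. cur (\<sigma> v) = 0" "\<And>v. \<not> flag (\<sigma> v)"
  shows "\<exists>c. rn (search_slots K n) \<sigma> = (\<lambda>v. (\<sigma> v)\<lparr>cur := c v\<rparr>) \<and>
    (\<forall>v\<in>V. c v = Min (links (rootf \<sigma>) (root (\<sigma> v))))"
proof -
  have "\<exists>c. rn (concat (map (\<lambda>b. level_slots K n b @ [Shift]) (rev [j..<3 * K]))) \<sigma>
      = (\<lambda>v. (\<sigma> v)\<lparr>cur := c v\<rparr>) \<and>
    (\<forall>v\<in>V. c v = Min (links (rootf \<sigma>) (root (\<sigma> v))) div 2 ^ j)" if "j \<le> 3 * K" for j
    using that
  proof (induction "3 * K - j" arbitrary: j)
    case 0
    \<comment> \<open>Codes have at most \<open>3 * K\<close> bits, so the initial value 0 of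
      \<open>cur\<close> is the correct empty prefix.\<close>
    have "Min (links (rootf \<sigma>) (root (\<sigma> v))) div 2 ^ (3 * K) = 0" if v: "v \<in> V" for v
    proof -
      have "links (rootf \<sigma>) (root (\<sigma> v)) \<noteq> {}"
        using v unfolding links_def by blast
      then show ?thesis
        using links_less[OF F Min_in[OF finite_links]] by simp
    qed
    then show ?case
      using 0 init(1) by (intro exI[of _ "\<lambda>_. 0"]) auto
  next
    case (Suc k)
    then obtain c where c: "rn (concat (map (\<lambda>b. level_slots K n b @ [Shift]) (rev [Suc j..<3 * K]))) \<sigma>
      = (\<lambda>v. (\<sigma> v)\<lparr>cur := c v\<rparr>)" "\<forall>v\<in>V. c v = Min (links (rootf \<sigma>) (root (\<sigma> v))) div 2 ^ Suc j"
      using Suc.hyps(1)[of "Suc j"] by fastforce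
    have "\<exists>c'. rn (level_slots K n j @ [Shift]) (\<lambda>v. (\<sigma> v)\<lparr>cur := c v\<rparr>)
        = (\<lambda>v. ((\<sigma> v)\<lparr>cur := c v\<rparr>)\<lparr>cur := c' v\<rparr>) \<and>
      (\<forall>v\<in>V. c' v = Min (links (rootf (\<lambda>v. (\<sigma> v)\<lparr>cur := c v\<rparr>)) (root ((\<sigma> v)\<lparr>cur := c v\<rparr>))) div 2 ^ j)"
      using F init(2) c(2) by (intro level_phases) simp_all
    then obtain c' where "rn (level_slots K n j @ [Shift]) (\<lambda>v. (\<sigma> v)\<lparr>cur := c v\<rparr>)
        = (\<lambda>v. (\<sigma> v)\<lparr>cur := c' v\<rparr>)"
      "\<forall>v\<in>V. c' v = Min (links (rootf \<sigma>) (root (\<sigma> v))) div 2 ^ j"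
      by auto
    moreover have "[j..<3 * K] = j # [Suc j..<3 * K]"
      using Suc.hyps(2) by (simp add: upt_conv_Cons)
    ultimately show ?case
      using c(1) by (intro exI[of _ c']) (simp del: upt_Suc)
  qed
  from this[of 0] show ?thesis
    by (simp add: search_slots_def)
qed

end

section \<open>Relabelling the hooked clusters\<close>

lemma hook_decode:
  assumes "u < 2 ^ K" "w < 2 ^ K"
  shows "hook_root K ((a * 2 ^ K + w) * 2 ^ K + u) = a"
    "hook_via K ((a * 2 ^ K + w) * 2 ^ K + u) = w"
    "hook_from K ((a * 2 ^ K + w) * 2 ^ K + u) = u"
  using assms by (simp_all add: hook_root_def hook_via_def hook_from_def)

lemma settled_adopt:
  "settled (adopt fb x) \<longleftrightarrow> settled x \<or> (\<exists>r d u mo. fb = Received ([r, d, u], mo))"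
  by (cases "(fb, x)" rule: adopt.cases) simp_all

text \<open>\<open>\<tau>\<close> is the state just after \<open>Decide\<close>: the smallest link
  is known, new labels still equal the old ones, and precisely the clusters that hook to themselves
  count as settled.\<close>

locale relabelling = radio_network V E s m K n
  for V :: "nat set" and E :: "nat \<Rightarrow> nat \<Rightarrow> bool" and s :: nat and m :: 'm and K n :: nat +
  fixes \<tau> :: "nat \<Rightarrow> 'm st"
  assumes forest: "forest (\<lambda>v. root (\<tau> v)) (\<lambda>v. dep (\<tau> v)) (\<lambda>v. par (\<tau> v))"
    and cur_Min: "v \<in> V \<Longrightarrow> cur (\<tau> v) = Min (links (\<lambda>v. root (\<tau> v)) (root (\<tau> v)))"
    and settled_init: "v \<in> V \<Longrightarrow> settled (\<tau> v) \<longleftrightarrow> hook_root K (cur (\<tau> v)) = root (\<tau> v)"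
    and nlabels: "v \<in> V \<Longrightarrow> nroot (\<tau> v) = root (\<tau> v) \<and> ndep (\<tau> v) = dep (\<tau> v) \<and> npar (\<tau> v) = par (\<tau> v)"
    and msg_init: "v \<in> V \<Longrightarrow> root (\<tau> v) = 0 \<Longrightarrow> msg (\<tau> v) = Some m"
begin

definition "\<rho> v = root (\<tau> v)"
definition "\<delta> v = dep (\<tau> v)"
definition "\<pi> v = par (\<tau> v)"
definition "target r = hook_root K (Min (links \<rho> r))"
definition "via r = hook_via K (Min (links \<rho> r))"
definition "entry r = hook_from K (Min (links \<rho> r))"

lemma forest': "forest \<rho> \<delta> \<pi>"
  using forest by (simp add: forest_def \<rho>_def \<delta>_def \<pi>_def)

lemma cur_hook:
  assumes "v \<in> V"
  shows "hook_root K (cur (\<tau> v)) = target (\<rho> v)" "hook_via K (cur (\<tau> v)) = via (\<rho> v)"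
    "hook_from K (cur (\<tau> v)) = entry (\<rho> v)"
proof -
  have "(\<lambda>v. root (\<tau> v)) = \<rho>"
    by (simp add: \<rho>_def fun_eq_iff)
  then show "hook_root K (cur (\<tau> v)) = target (\<rho> v)" "hook_via K (cur (\<tau> v)) = via (\<rho> v)"
    "hook_from K (cur (\<tau> v)) = entry (\<rho> v)"
    using cur_Min[OF assms] by (simp_all add: target_def via_def entry_def \<rho>_def)
qed

lemma target_le_edge:
  assumes "x \<in> V" "y = x \<or> E x y"
  shows "target (\<rho> x) \<le> \<rho> y"
proof -
  have y: "y \<in> V"
    using assms edgeD by auto
  have "(\<rho> y * 2 ^ K + y) * 2 ^ K + x \<in> links \<rho> (\<rho> x)"
    using assms unfolding links_def by blast
  then have "Min (links \<rho> (\<rho> x)) \<le> (\<rho> y * 2 ^ K + y) * 2 ^ K + x"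
    using finite_links by (intro Min_le)
  then have "target (\<rho> x) \<le> hook_root K ((\<rho> y * 2 ^ K + y) * 2 ^ K + x)"
    unfolding target_def hook_root_def by (intro div_le_mono)
  then show ?thesis
    using hook_decode(1)[OF id_bounds(2)[OF assms(1)] id_bounds(2)[OF y]] by simp
qed

lemma target_le: "v \<in> V \<Longrightarrow> target (\<rho> v) \<le> \<rho> v"
  using target_le_edge[of v v] by simp

text \<open>The minimum is itself a link, so its decoded fields name genuine vertices. The case
  \<open>via = entry\<close> comes from the links of a vertex to itself.\<close>

lemma hook_link:
  assumes "v \<in> V"
  shows "entry (\<rho> v) \<in> V" "\<rho> (entry (\<rho> v)) = \<rho> v" "via (\<rho> v) \<in> V"
    "\<rho> (via (\<rho> v)) = target (\<rho> v)" "via (\<rho> v) = entry (\<rho> v) \<or> E (entry (\<rho> v)) (via (\<rho> v))"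
proof -
  have "links \<rho> (\<rho> v) \<noteq> {}"
    using assms unfolding links_def by blast
  then have "Min (links \<rho> (\<rho> v)) \<in> links \<rho> (\<rho> v)"
    using finite_links by (intro Min_in)
  then obtain u w where uw: "Min (links \<rho> (\<rho> v)) = (\<rho> w * 2 ^ K + w) * 2 ^ K + u"
    "u \<in> V" "\<rho> u = \<rho> v" "w = u \<or> E u w"
    unfolding links_def by blast
  then have w: "w \<in> V"
    using edgeD by auto
  have "target (\<rho> v) = \<rho> w" "via (\<rho> v) = w" "entry (\<rho> v) = u"
    unfolding target_def via_def entry_def uw(1)
    using hook_decode id_bounds(2)[OF uw(2)] id_bounds(2)[OF w] by simp_all
  then show "entry (\<rho> v) \<in> V" "\<rho> (entry (\<rho> v)) = \<rho> v" "via (\<rho> v) \<in> V"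
    "\<rho> (via (\<rho> v)) = target (\<rho> v)" "via (\<rho> v) = entry (\<rho> v) \<or> E (entry (\<rho> v)) (via (\<rho> v))"
    using uw w by simp_all
qed

section \<open>Which vertices are settled, slot by slot and stage by stage\<close>

definition agrees :: "(nat \<Rightarrow> 'm st) \<Rightarrow> bool" where
  "agrees \<sigma> \<longleftrightarrow> (\<forall>v. root (\<sigma> v) = \<rho> v \<and> dep (\<sigma> v) = \<delta> v \<and> par (\<sigma> v) = \<pi> v \<and> cur (\<sigma> v) = cur (\<tau> v))"

lemma agreesD:
  assumes "agrees \<sigma>"
  shows "root (\<sigma> v) = \<rho> v" "dep (\<sigma> v) = \<delta> v" "par (\<sigma> v) = \<pi> v" "cur (\<sigma> v) = cur (\<tau> v)"
  using assms by (simp_all add: agrees_def)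

lemma agrees_init: "agrees \<tau>"
  by (simp add: agrees_def \<rho>_def \<delta>_def \<pi>_def)

lemma agrees_step: "agrees \<sigma> \<Longrightarrow> l \<noteq> Start \<Longrightarrow> l \<noteq> Shift \<Longrightarrow> agrees (stp l \<sigma>)"
  by (simp add: agrees_def step_preserves_labels)

lemma agrees_run: "agrees \<sigma> \<Longrightarrow> Start \<notin> set ls \<Longrightarrow> Shift \<notin> set ls \<Longrightarrow> agrees (rn ls \<sigma>)"
proof (induction ls arbitrary: \<sigma>)
  case (Cons l ls)
  have "agrees (stp l \<sigma>)"
    using Cons.prems by (intro agrees_step) auto
  then show ?case
    using Cons by simp
qed simp

text \<open>Unlike in \<open>step_Up\<close>, noise is of no use: the label must be read, so exactly
  one settled child has to send.\<close>

lemma settled_Relabel_Up: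
  assumes A: "agrees \<sigma>"
  shows "settled (stp (Relabel_Up r d p) \<sigma> v) \<longleftrightarrow> settled (\<sigma> v) \<or>
    v = p \<and> \<rho> v = r \<and> Suc (\<delta> v) = d \<and>
    (\<exists>!u. E v u \<and> \<rho> u = r \<and> \<delta> u = d \<and> \<pi> u = v \<and> settled (\<sigma> u))"
proof -
  define a where "a = (\<lambda>u. emit K u (Relabel_Up r d p) (\<sigma> u))"
  define fb where "fb = cd_feedback V E a v"
  note ag = agreesD[OF A]
  have tr: "a u = Transmit q \<longleftrightarrow> q = label_packet u (\<sigma> u) \<and> \<rho> u = r \<and> \<delta> u = d \<and> \<pi> u = p \<and> settled (\<sigma> u)" for u q
    by (auto simp: a_def ag)
  have li: "a v = Listen \<longleftrightarrow> \<rho> v = r \<and> v = p \<and> Suc (\<delta> v) = d \<and> \<not> settled (\<sigma> v)"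
    by (auto simp: a_def ag)
  have st: "settled (stp (Relabel_Up r d p) \<sigma> v) \<longleftrightarrow>
      settled (\<sigma> v) \<or> (\<exists>x y z mo. fb = Received ([x, y, z], mo))"
    by (simp add: step_def settled_adopt fb_def a_def)
  show ?thesis
  proof (cases "settled (\<sigma> v)")
    case False
    have "v = p \<and> \<rho> v = r \<and> Suc (\<delta> v) = d \<and>
      (\<exists>!u. E v u \<and> \<rho> u = r \<and> \<delta> u = d \<and> \<pi> u = v \<and> settled (\<sigma> u))" if "fb = Received q" for q
    proof -
      have L: "a v = Listen" and "\<exists>u\<in>V. E v u \<and> a u = Transmit q"
        using cd_feedback_receivedD that unfolding fb_def by blast+
      then obtain u where u: "u \<in> V" "E v u" "a u = Transmit q" by blast
      have "w = u" if "E v w" "\<rho> w = r" "\<delta> w = d" "\<pi> w = v" "settled (\<sigma> w)" for w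
      proof (rule ccontr)
        assume "w \<noteq> u"
        moreover have "a w = Transmit (label_packet w (\<sigma> w))"
          using that L li tr by blast
        ultimately have "fb \<noteq> Received q"
          using cd_feedback_not_received[of u V E v a q w] u edgeD(2)[OF that(1)] that(1)
          unfolding fb_def by blast
        then show False using \<open>fb = Received q\<close> by simp
      qed
      then show ?thesis
        using L li u tr by metis
    qed
    moreover have "\<exists>x y z mo. fb = Received ([x, y, z], mo)"
      if asm: "v = p" "\<rho> v = r" "Suc (\<delta> v) = d"
       "\<exists>!u. E v u \<and> \<rho> u = r \<and> \<delta> u = d \<and> \<pi> u = v \<and> settled (\<sigma> u)"
    proof -
      obtain u where u: "E v u" "\<rho> u = r" "\<delta> u = d" "\<pi> u = v" "settled (\<sigma> u)"
        using asm(4) by blast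
      have "fb = Received (label_packet u (\<sigma> u))"
        unfolding fb_def
      proof (rule cd_feedback_unique)
        show "a v = Listen" using li asm False by blast
        show "u \<in> V" "E v u" using u edgeD by auto
        show "a u = Transmit (label_packet u (\<sigma> u))" using tr u asm by blast
        show "w = u" if "w \<in> V" "E v w" "a w = Transmit q" for w q
          using that asm(1,4) u tr by metis
      qed
      then show ?thesis by (simp add: label_packet_def)
    qed
    ultimately show ?thesis
      unfolding st using False by blast
  qed (use st in blast)
qed

lemma settled_Relabel_Down:
  assumes A: "agrees \<sigma>"
  shows "settled (stp (Relabel_Down r d p) \<sigma> v) \<longleftrightarrow> settled (\<sigma> v) \<or>
    \<rho> v = r \<and> \<pi> v = p \<and> \<delta> v = Suc d \<and> E v p \<and> \<rho> p = r \<and> \<delta> p = d \<and> settled (\<sigma> p)"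
proof -
  define a where "a = (\<lambda>u. emit K u (Relabel_Down r d p) (\<sigma> u))"
  define fb where "fb = cd_feedback V E a v"
  note ag = agreesD[OF A]
  have tr: "a u = Transmit q \<longleftrightarrow> q = label_packet u (\<sigma> u) \<and> \<rho> u = r \<and> u = p \<and> \<delta> u = d \<and> settled (\<sigma> u)" for u q
    by (auto simp: a_def ag)
  have li: "a v = Listen \<longleftrightarrow> \<rho> v = r \<and> \<pi> v = p \<and> \<delta> v = Suc d \<and> \<not> settled (\<sigma> v)"
    by (auto simp: a_def ag)
  have st: "settled (stp (Relabel_Down r d p) \<sigma> v) \<longleftrightarrow>
      settled (\<sigma> v) \<or> (\<exists>x y z mo. fb = Received ([x, y, z], mo))"
    by (simp add: step_def settled_adopt fb_def a_def)
  have "\<rho> v = r \<and> \<pi> v = p \<and> \<delta> v = Suc d \<and> E v p \<and> \<rho> p = r \<and> \<delta> p = d \<and> settled (\<sigma> p)"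
    if "fb = Received q" for q
  proof -
    have "a v = Listen" and "\<exists>u\<in>V. E v u \<and> a u = Transmit q"
      using cd_feedback_receivedD[OF that[unfolded fb_def]] by blast+
    then show ?thesis
      unfolding li tr by auto
  qed
  moreover have "\<exists>x y z mo. fb = Received ([x, y, z], mo)" if "\<not> settled (\<sigma> v)"
    "\<rho> v = r" "\<pi> v = p" "\<delta> v = Suc d" "E v p" "\<rho> p = r" "\<delta> p = d" "settled (\<sigma> p)"
  proof -
    have "fb = Received (label_packet p (\<sigma> p))"
      unfolding fb_def
      by (rule cd_feedback_unique) (use that edgeD(2) in \<open>auto simp: li tr\<close>)
    then show ?thesis by (simp add: label_packet_def)
  qed
  ultimately show ?thesis
    unfolding st by blast
qed

lemma settled_Announce:
  assumes A: "agrees \<sigma>" and "v \<in> V"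
  shows "settled (stp (Announce r w) \<sigma> v) \<longleftrightarrow> settled (\<sigma> v) \<or>
    target (\<rho> v) = r \<and> via (\<rho> v) = w \<and> entry (\<rho> v) = v \<and> E v w \<and> \<rho> w = r \<and> settled (\<sigma> w)"
proof -
  define a where "a = (\<lambda>u. emit K u (Announce r w) (\<sigma> u))"
  define fb where "fb = cd_feedback V E a v"
  note ag = agreesD[OF A]
  have tr: "a u = Transmit q \<longleftrightarrow> q = label_packet u (\<sigma> u) \<and> \<rho> u = r \<and> u = w \<and> settled (\<sigma> u)" for u q
    by (auto simp: a_def ag)
  have li: "a v = Listen \<longleftrightarrow> target (\<rho> v) = r \<and> via (\<rho> v) = w \<and> entry (\<rho> v) = v \<and> \<not> settled (\<sigma> v)"
    by (auto simp: a_def ag cur_hook[OF assms(2)])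
  have st: "settled (stp (Announce r w) \<sigma> v) \<longleftrightarrow>
      settled (\<sigma> v) \<or> (\<exists>x y z mo. fb = Received ([x, y, z], mo))"
    by (simp add: step_def settled_adopt fb_def a_def)
  have "target (\<rho> v) = r \<and> via (\<rho> v) = w \<and> entry (\<rho> v) = v \<and> E v w \<and> \<rho> w = r \<and> settled (\<sigma> w)"
    if "fb = Received q" for q
  proof -
    have "a v = Listen" and "\<exists>u\<in>V. E v u \<and> a u = Transmit q"
      using cd_feedback_receivedD[OF that[unfolded fb_def]] by blast+
    then show ?thesis
      unfolding li tr by auto
  qed
  moreover have "\<exists>x y z mo. fb = Received ([x, y, z], mo)" if "\<not> settled (\<sigma> v)"
    "target (\<rho> v) = r" "via (\<rho> v) = w" "entry (\<rho> v) = v" "E v w" "\<rho> w = r" "settled (\<sigma> w)"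
  proof -
    have "fb = Received (label_packet w (\<sigma> w))"
      unfolding fb_def
      by (rule cd_feedback_unique) (use that edgeD(2) in \<open>auto simp: li tr\<close>)
    then show ?thesis by (simp add: label_packet_def)
  qed
  ultimately show ?thesis
    unfolding st by blast
qed

lemma settled_run_Up:
  assumes A: "agrees \<sigma>"
  shows "settled (rn (map (Relabel_Up r d) [0..<M]) \<sigma> v) \<longleftrightarrow> settled (\<sigma> v) \<or>
    v < M \<and> \<rho> v = r \<and> Suc (\<delta> v) = d \<and>
    (\<exists>!u. E v u \<and> \<rho> u = r \<and> \<delta> u = d \<and> \<pi> u = v \<and> settled (\<sigma> u))"
proof (induction M arbitrary: v)
  case (Suc M)
  define \<sigma>' where "\<sigma>' = rn (map (Relabel_Up r d) [0..<M]) \<sigma>"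
  have A': "agrees \<sigma>'"
    unfolding \<sigma>'_def by (rule agrees_run[OF A]) auto
  have same: "settled (\<sigma>' u) \<longleftrightarrow> settled (\<sigma> u)" if "\<delta> u = d" for u
    using Suc[of u] that by (auto simp: \<sigma>'_def)
  define Q where "Q \<longleftrightarrow> (\<exists>!u. E v u \<and> \<rho> u = r \<and> \<delta> u = d \<and> \<pi> u = v \<and> settled (\<sigma> u))"
  have Q: "(\<exists>!u. E v u \<and> \<rho> u = r \<and> \<delta> u = d \<and> \<pi> u = v \<and> settled (\<sigma>' u)) \<longleftrightarrow> Q"
    unfolding Q_def by (intro arg_cong[where f = Ex1] ext) (use same in blast)
  have "rn (map (Relabel_Up r d) [0..<Suc M]) \<sigma> = stp (Relabel_Up r d M) \<sigma>'"
    by (simp add: \<sigma>'_def)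
  then show ?case
    using Suc[of v] unfolding \<sigma>'_def[symmetric] Q_def[symmetric]
    by (simp only: settled_Relabel_Up[OF A'] Q less_Suc_eq) blast
qed simp

lemma settled_run_Down:
  assumes A: "agrees \<sigma>"
  shows "settled (rn (map (Relabel_Down r d) [0..<M]) \<sigma> v) \<longleftrightarrow> settled (\<sigma> v) \<or>
    \<rho> v = r \<and> \<pi> v < M \<and> \<delta> v = Suc d \<and> E v (\<pi> v) \<and> \<rho> (\<pi> v) = r \<and> \<delta> (\<pi> v) = d \<and> settled (\<sigma> (\<pi> v))"
proof (induction M arbitrary: v)
  case (Suc M)
  define \<sigma>' where "\<sigma>' = rn (map (Relabel_Down r d) [0..<M]) \<sigma>"
  have A': "agrees \<sigma>'"
    unfolding \<sigma>'_def by (rule agrees_run[OF A]) auto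
  have same: "settled (\<sigma>' u) \<longleftrightarrow> settled (\<sigma> u)" if "\<delta> u = d" for u
    using Suc[of u] that by (auto simp: \<sigma>'_def)
  have "rn (map (Relabel_Down r d) [0..<Suc M]) \<sigma> = stp (Relabel_Down r d M) \<sigma>'"
    by (simp add: \<sigma>'_def)
  then show ?case
    using Suc[of v] same unfolding \<sigma>'_def[symmetric]
    by (simp only: settled_Relabel_Down[OF A'] less_Suc_eq) blast
qed simp

text \<open>With cluster \<open>r\<close> fully settled, its senders are fixed beforehand. Listeners
  are unsettled, hence outside the cluster, and settling them influences no later slot of the
  stage.\<close>

lemma settled_run_Announce:
  assumes A: "agrees \<sigma>" and all: "\<And>v. v \<in> V \<Longrightarrow> \<rho> v = r \<Longrightarrow> settled (\<sigma> v)" and v: "v \<in> V"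
  shows "settled (rn (map (Announce r) [0..<M]) \<sigma> v) \<longleftrightarrow> settled (\<sigma> v) \<or>
    target (\<rho> v) = r \<and> via (\<rho> v) < M \<and> entry (\<rho> v) = v \<and> E v (via (\<rho> v)) \<and> \<rho> (via (\<rho> v)) = r"
  using v
proof (induction M arbitrary: v)
  case (Suc M)
  define \<sigma>' where "\<sigma>' = rn (map (Announce r) [0..<M]) \<sigma>"
  have A': "agrees \<sigma>'"
    unfolding \<sigma>'_def by (rule agrees_run[OF A]) auto
  have same: "settled (\<sigma>' u)" if "E v u" "\<rho> u = r" for u
    using Suc.IH[of u] that all edgeD(2) by (auto simp: \<sigma>'_def)
  have "rn (map (Announce r) [0..<Suc M]) \<sigma> = stp (Announce r M) \<sigma>'"
    by (simp add: \<sigma>'_def)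
  then show ?case
    using Suc.IH[OF Suc.prems] same unfolding \<sigma>'_def[symmetric]
    by (simp only: settled_Announce[OF A' Suc.prems] less_Suc_eq) blast
qed simp

text \<open>The label climbs from \<open>e\<close> along a single path. At every level one settled
  vertex is the topmost so far: either \<open>e\<close>, not yet reached by the sweep, or the
  ancestor of \<open>e\<close> at depth \<open>j\<close>. Its uniqueness is what protects its parent
  from collisions.\<close>

lemma relabel_up_phases:
  assumes A: "agrees \<sigma>"
    and init: "\<And>v. v \<in> V \<Longrightarrow> \<rho> v = r \<Longrightarrow> settled (\<sigma> v) \<longleftrightarrow> v = e"
    and e: "e \<in> V" "\<rho> e = r"
  defines "\<sigma>' \<equiv> \<lambda>j. rn (grid (Relabel_Up r) (rev [Suc j..<n]) (2 ^ K)) \<sigma>"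
  shows "\<exists>!x. x \<in> V \<and> \<rho> x = r \<and> settled (\<sigma>' j x) \<and> \<delta> x \<le> j"
proof (induction "n - Suc j" arbitrary: j)
  case 0
  then have "\<sigma>' j = \<sigma>"
    by (simp add: \<sigma>'_def grid_def)
  moreover have "\<delta> e \<le> j"
    using 0 forest_depth_less[OF forest' e(1)] by simp
  ultimately show ?case
    using init e by (intro ex1I[of _ e]) (simp, blast)
next
  case (Suc k)
  have "k = n - Suc (Suc j)"
    using Suc.hyps(2) by simp
  from Suc.hyps(1)[OF this] obtain x where
    x: "x \<in> V" "\<rho> x = r" "settled (\<sigma>' (Suc j) x)" "\<delta> x \<le> Suc j" and
    uniq: "\<And>y. y \<in> V \<Longrightarrow> \<rho> y = r \<Longrightarrow> settled (\<sigma>' (Suc j) y) \<Longrightarrow> \<delta> y \<le> Suc j \<Longrightarrow> y = x"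
    by (elim ex1E) blast
  have A': "agrees (\<sigma>' (Suc j))"
    unfolding \<sigma>'_def by (rule agrees_run[OF A]) (auto simp: set_grid)
  have "[Suc j..<n] = Suc j # [Suc (Suc j)..<n]"
    using Suc.hyps(2) by (simp add: upt_conv_Cons)
  then have "\<sigma>' j = rn (map (Relabel_Up r (Suc j)) [0..<2 ^ K]) (\<sigma>' (Suc j))"
    by (simp add: \<sigma>'_def grid_def)
  then have st: "settled (\<sigma>' j v) \<longleftrightarrow> settled (\<sigma>' (Suc j) v) \<or>
    v < 2 ^ K \<and> \<rho> v = r \<and> \<delta> v = j \<and>
    (\<exists>!u. E v u \<and> \<rho> u = r \<and> \<delta> u = Suc j \<and> \<pi> u = v \<and> settled (\<sigma>' (Suc j) u))" for v
    by (simp only: settled_run_Up[OF A'] nat.inject)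
  \<comment> \<open>Every settled vertex at the level now sending is the unique \<open>x\<close>, so
    a parent hears one child or none.\<close>
  have child: "u = x" if "E v u" "\<rho> u = r" "\<delta> u = Suc j" "settled (\<sigma>' (Suc j) u)" for u v
    using that edgeD(2) by (intro uniq) auto
  have new: "\<delta> x = Suc j \<and> \<pi> x = v" if "settled (\<sigma>' j v)" "\<not> settled (\<sigma>' (Suc j) v)" for v
  proof -
    have "\<exists>!u. E v u \<and> \<rho> u = r \<and> \<delta> u = Suc j \<and> \<pi> u = v \<and> settled (\<sigma>' (Suc j) u)"
      using iffD1[OF st that(1)] that(2) by simp
    then obtain u where u: "E v u" "\<rho> u = r" "\<delta> u = Suc j" "\<pi> u = v" "settled (\<sigma>' (Suc j) u)"
      by (elim ex1E conjE)
    then have "u = x"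
      by (intro child)
    then show ?thesis
      using u by simp
  qed
  show ?case
  proof (cases "\<delta> x = Suc j")
    case True
    note p = forest_parent[OF forest' x(1) True]
    have "\<exists>!u. E (\<pi> x) u \<and> \<rho> u = r \<and> \<delta> u = Suc j \<and> \<pi> u = \<pi> x \<and> settled (\<sigma>' (Suc j) u)"
      using child p x True edgeD(4) by (intro ex1I[of _ x]) blast+
    then have "settled (\<sigma>' j (\<pi> x))"
      unfolding st using p x id_bounds(2)[OF p(1)] by simp
    moreover have "y = \<pi> x" if "y \<in> V" "\<rho> y = r" "settled (\<sigma>' j y)" "\<delta> y \<le> j" for y
    proof (cases "settled (\<sigma>' (Suc j) y)")
      case True
      then have "y = x"
        using that by (intro uniq) auto
      then show ?thesis
        using that \<open>\<delta> x = Suc j\<close> by simp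
    next
      case False
      then show ?thesis
        using new[OF that(3)] by simp
    qed
    moreover have "\<pi> x \<in> V \<and> \<rho> (\<pi> x) = r \<and> \<delta> (\<pi> x) \<le> j"
      using p x(2) by simp
    ultimately show ?thesis
      by (intro ex1I[of _ "\<pi> x"]) blast+
  next
    case False
    have "y = x" if "y \<in> V" "\<rho> y = r" "settled (\<sigma>' j y)" "\<delta> y \<le> j" for y
    proof (cases "settled (\<sigma>' (Suc j) y)")
      case True
      then show ?thesis
        using that by (intro uniq) auto
    next
      case no: False
      then show ?thesis
        using new[OF that(3)] False by simp
    qed
    moreover have "settled (\<sigma>' j x)"
      unfolding st using x(3) by simp
    moreover have "x \<in> V \<and> \<rho> x = r \<and> \<delta> x \<le> j"
      using x False by simp
    ultimately show ?thesis
      by (intro ex1I[of _ x]) blast+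
  qed
qed

lemma relabel_down_phases:
  assumes A: "agrees \<sigma>"
    and init: "\<And>v. v \<in> V \<Longrightarrow> \<rho> v = r \<Longrightarrow> \<delta> v = 0 \<Longrightarrow> settled (\<sigma> v)"
    and v: "v \<in> V" "\<rho> v = r" "\<delta> v \<le> j"
  shows "settled (rn (grid (Relabel_Down r) [0..<j] (2 ^ K)) \<sigma> v)"
  using v
proof (induction j arbitrary: v)
  case 0
  then show ?case
    using init by (simp add: grid_def)
next
  case (Suc j)
  define \<sigma>' where "\<sigma>' = rn (grid (Relabel_Down r) [0..<j] (2 ^ K)) \<sigma>"
  have A': "agrees \<sigma>'"
    unfolding \<sigma>'_def by (rule agrees_run[OF A]) (auto simp: set_grid)
  have "rn (grid (Relabel_Down r) [0..<Suc j] (2 ^ K)) \<sigma> = rn (map (Relabel_Down r j) [0..<2 ^ K]) \<sigma>'"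
    by (simp add: \<sigma>'_def grid_def)
  then have st: "settled (rn (grid (Relabel_Down r) [0..<Suc j] (2 ^ K)) \<sigma> v) \<longleftrightarrow> settled (\<sigma>' v) \<or>
    \<rho> v = r \<and> \<pi> v < 2 ^ K \<and> \<delta> v = Suc j \<and> E v (\<pi> v) \<and> \<rho> (\<pi> v) = r \<and> \<delta> (\<pi> v) = j \<and> settled (\<sigma>' (\<pi> v))"
    by (simp only: settled_run_Down[OF A'])
  show ?case
  proof (cases "\<delta> v = Suc j")
    case True
    note p = forest_parent[OF forest' Suc.prems(1) True]
    have "settled (\<sigma>' (\<pi> v))"
      unfolding \<sigma>'_def using Suc.prems p by (intro Suc.IH) simp_all
    then show ?thesis
      unfolding st using p True Suc.prems id_bounds(2)[OF p(1)] by simp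
  next
    case False
    then have "settled (\<sigma>' v)"
      unfolding \<sigma>'_def using Suc.prems by (intro Suc.IH) simp_all
    then show ?thesis
      unfolding st by simp
  qed
qed

definition tree_slot :: "nat \<Rightarrow> slot \<Rightarrow> bool" where
  "tree_slot r l \<longleftrightarrow> (\<exists>d p. l = Relabel_Up r d p \<or> l = Relabel_Down r d p)"

lemma run_tree_slots:
  assumes "agrees \<sigma>" "\<And>l. l \<in> set ls \<Longrightarrow> tree_slot r l"
  shows "settled (\<sigma> v) \<Longrightarrow> settled (rn ls \<sigma> v)"
    "\<rho> v \<noteq> r \<Longrightarrow> settled (rn ls \<sigma> v) \<longleftrightarrow> settled (\<sigma> v)"
proof -
  have "(settled (\<sigma> v) \<longrightarrow> settled (rn ls \<sigma> v)) \<and>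
    (\<rho> v \<noteq> r \<longrightarrow> settled (rn ls \<sigma> v) = settled (\<sigma> v))"
    using assms
  proof (induction ls arbitrary: \<sigma>)
    case (Cons l ls)
    have "tree_slot r l"
      using Cons.prems by simp
    then have "(settled (\<sigma> v) \<longrightarrow> settled (stp l \<sigma> v)) \<and>
        (\<rho> v \<noteq> r \<longrightarrow> settled (stp l \<sigma> v) = settled (\<sigma> v))" "agrees (stp l \<sigma>)"
      using Cons.prems(1) agrees_step[OF Cons.prems(1), of l] unfolding tree_slot_def
      by (elim exE disjE; simp add: settled_Relabel_Up settled_Relabel_Down)+
    then show ?case
      using Cons.IH[of "stp l \<sigma>"] Cons.prems by auto
  qed simp
  then show "settled (\<sigma> v) \<Longrightarrow> settled (rn ls \<sigma> v)"
    "\<rho> v \<noteq> r \<Longrightarrow> settled (rn ls \<sigma> v) \<longleftrightarrow> settled (\<sigma> v)"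
    by auto
qed

text \<open>The situation when stage \<open>r\<close> begins: clusters with smaller keys are
  finished, self-hooking clusters never change, and a cluster whose target is finished has heard the
  announcement at its entry vertex only.\<close>

definition settled_before :: "nat \<Rightarrow> nat \<Rightarrow> bool" where
  "settled_before r v \<longleftrightarrow> \<rho> v < r \<or> target (\<rho> v) = \<rho> v \<or> target (\<rho> v) < r \<and> v = entry (\<rho> v)"

lemma stage_phases:
  assumes A: "agrees \<sigma>" and before: "\<And>v. v \<in> V \<Longrightarrow> settled (\<sigma> v) \<longleftrightarrow> settled_before r v"
    and v: "v \<in> V"
  shows "settled (rn (stage_slots K n r) \<sigma> v) \<longleftrightarrow> settled_before (Suc r) v"
proof -
  define \<sigma>1 where "\<sigma>1 = rn (grid (Relabel_Up r) (rev [1..<n]) (2 ^ K)) \<sigma>"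
  define \<sigma>2 where "\<sigma>2 = rn (grid (Relabel_Down r) [0..<n] (2 ^ K)) \<sigma>1"
  have A1: "agrees \<sigma>1"
    unfolding \<sigma>1_def by (rule agrees_run[OF A]) (auto simp: set_grid)
  have A2: "agrees \<sigma>2"
    unfolding \<sigma>2_def by (rule agrees_run[OF A1]) (auto simp: set_grid)
  have t1: "tree_slot r l" if "l \<in> set (grid (Relabel_Up r) (rev [1..<n]) (2 ^ K))" for l
    using that by (auto simp: set_grid tree_slot_def)
  have t2: "tree_slot r l" if "l \<in> set (grid (Relabel_Down r) [0..<n] (2 ^ K))" for l
    using that by (auto simp: set_grid tree_slot_def)
  have other: "settled (\<sigma>2 u) \<longleftrightarrow> settled (\<sigma> u)" if "\<rho> u \<noteq> r" for u
    using run_tree_slots(2)[OF A t1 that] run_tree_slots(2)[OF A1 t2 that]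
    unfolding \<sigma>2_def \<sigma>1_def by simp
  have roots: "settled (\<sigma>1 u)" if u: "u \<in> V" "\<rho> u = r" "\<delta> u = 0" for u
  proof (cases "target r = r")
    case True
    then have "settled (\<sigma> u)"
      using before u by (simp add: settled_before_def)
    then show ?thesis
      using run_tree_slots(1)[OF A t1] unfolding \<sigma>1_def by simp
  next
    case False
    \<comment> \<open>Keys decrease along hooks, so the target's stage is over and
      \<open>before\<close> makes \<open>entry r\<close> the one settled vertex of this
      cluster.\<close>
    then have "target r < r"
      using target_le[OF u(1)] u(2) by simp
    then have "settled (\<sigma> w) \<longleftrightarrow> w = entry r" if "w \<in> V" "\<rho> w = r" for w
      using before[OF that(1)] that by (auto simp: settled_before_def)
    then have "\<exists>!x. x \<in> V \<and> \<rho> x = r \<and> settled (\<sigma>1 x) \<and> \<delta> x \<le> 0"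
      unfolding \<sigma>1_def One_nat_def
      by (rule relabel_up_phases[OF A, where e = "entry r"])
        (use hook_link[OF u(1)] u(2) in simp_all)
    then obtain x where "x \<in> V" "\<rho> x = r" "settled (\<sigma>1 x)" "\<delta> x \<le> 0"
      by (elim ex1E) blast
    moreover from this have "x = u"
      using forest_root_unique[OF forest'] u by simp
    ultimately show ?thesis by simp
  qed
  have all: "settled (\<sigma>2 u)" if u: "u \<in> V" "\<rho> u = r" for u
    unfolding \<sigma>2_def
  proof (rule relabel_down_phases[OF A1 _ u])
    show "settled (\<sigma>1 w)" if "w \<in> V" "\<rho> w = r" "\<delta> w = 0" for w
      using that by (rule roots)
    show "\<delta> u \<le> n"
      using forest_depth_less[OF forest' u(1)] by (rule less_imp_le)
  qed
  have "rn (stage_slots K n r) \<sigma> = rn (map (Announce r) [0..<2 ^ K]) \<sigma>2"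
    by (simp add: stage_slots_def \<sigma>1_def \<sigma>2_def)
  then have st: "settled (rn (stage_slots K n r) \<sigma> v) \<longleftrightarrow> settled (\<sigma>2 v) \<or>
    target (\<rho> v) = r \<and> via (\<rho> v) < 2 ^ K \<and> entry (\<rho> v) = v \<and> E v (via (\<rho> v)) \<and> \<rho> (via (\<rho> v)) = r"
    using settled_run_Announce[OF A2 all v] by simp
  show ?thesis
  proof (cases "\<rho> v = r")
    case True
    then show ?thesis
      unfolding st using all[OF v] by (simp add: settled_before_def)
  next
    case False
    note h = hook_link[OF v]
    have "target (\<rho> v) = r \<and> via (\<rho> v) < 2 ^ K \<and> entry (\<rho> v) = v \<and> E v (via (\<rho> v)) \<and> \<rho> (via (\<rho> v)) = r
      \<longleftrightarrow> target (\<rho> v) = r \<and> v = entry (\<rho> v)" (is "?L \<longleftrightarrow> ?R")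
    proof
      assume R: ?R
      \<comment> \<open>The two ends lie in different clusters, so the link is a real edge over
        which the announcement is heard.\<close>
      then have "via (\<rho> v) \<noteq> entry (\<rho> v)"
        using h(2,4) False by auto
      then show ?L
        using R h id_bounds(2)[OF h(3)] by metis
    qed simp
    then show ?thesis
      unfolding st other[OF False] before[OF v] using False by (auto simp: settled_before_def)
  qed
qed

lemma all_settled:
  assumes "v \<in> V"
  shows "settled (rn (relabel_slots K n) \<tau> v)"
proof -
  have "settled (rn (concat (map (stage_slots K n) [0..<r])) \<tau> v) \<longleftrightarrow> settled_before r v"
    if "v \<in> V" for r v
    using that
  proof (induction r arbitrary: v)
    case 0
    then show ?case
      using settled_init[OF 0] cur_hook(1)[OF 0] by (simp add: settled_before_def \<rho>_def)
  next
    case (Suc r)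
    define \<sigma> where "\<sigma> = rn (concat (map (stage_slots K n) [0..<r])) \<tau>"
    have "agrees \<sigma>"
      unfolding \<sigma>_def by (rule agrees_run[OF agrees_init]) (auto simp: stage_slots_def set_grid)
    from stage_phases[OF this] Suc show ?case
      by (simp add: \<sigma>_def)
  qed
  then show ?thesis
    using assms forest_root_less[OF forest' assms] by (simp add: relabel_slots_def settled_before_def)
qed

text \<open>The parent is required to be settled because settled vertices never change again; this
  makes the condition stable under all later slots.\<close>

definition label_ok :: "(nat \<Rightarrow> 'm st) \<Rightarrow> nat \<Rightarrow> bool" where
  "label_ok \<sigma> v \<longleftrightarrow> nroot (\<sigma> v) = hook_end target (\<rho> v) \<and> (nroot (\<sigma> v) = 0 \<longrightarrow> msg (\<sigma> v) = Some m) \<and>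
    (ndep (\<sigma> v) = 0 \<and> nroot (\<sigma> v) = key v \<or>
     ndep (\<sigma> v) \<noteq> 0 \<and> E v (npar (\<sigma> v)) \<and> settled (\<sigma> (npar (\<sigma> v))) \<and>
     ndep (\<sigma> v) = Suc (ndep (\<sigma> (npar (\<sigma> v)))) \<and> nroot (\<sigma> v) = nroot (\<sigma> (npar (\<sigma> v))))"

definition relabel_slot :: "slot \<Rightarrow> bool" where
  "relabel_slot l \<longleftrightarrow> (\<exists>r d p. l = Relabel_Up r d p \<or> l = Relabel_Down r d p \<or> l = Announce r p)"

text \<open>One description for all three kinds of slots: the sender lies either in the same cluster
  or in its target cluster, and both have the same chain end. Copying the sender's label is thus
  always right.\<close>

lemma relabel_step_cases:
  assumes A: "agrees \<sigma>" and l: "relabel_slot l" and v: "v \<in> V"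
  shows "stp l \<sigma> v = \<sigma> v \<or> \<not> settled (\<sigma> v) \<and> (\<exists>u. E v u \<and> settled (\<sigma> u) \<and>
    hook_end target (\<rho> v) = hook_end target (\<rho> u) \<and>
    stp l \<sigma> v = (\<sigma> v)\<lparr>nroot := nroot (\<sigma> u), ndep := Suc (ndep (\<sigma> u)), npar := u,
      msg := msg (\<sigma> u), settled := True\<rparr>)"
proof -
  note ag = agreesD[OF A]
  define fb where "fb = cd_feedback V E (\<lambda>u. emit K u l (\<sigma> u)) v"
  have st: "stp l \<sigma> v = adopt fb (\<sigma> v)"
    using l unfolding relabel_slot_def by (auto simp: step_def fb_def)
  show ?thesis
  proof (cases "\<exists>p. fb = Received p")
    case False
    then have "adopt fb (\<sigma> v) = \<sigma> v"
      by (cases fb) auto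
    then show ?thesis using st by simp
  next
    case True
    then obtain p where p: "fb = Received p" by auto
    have L: "emit K v l (\<sigma> v) = Listen" and "\<exists>u\<in>V. E v u \<and> emit K u l (\<sigma> u) = Transmit p"
      using cd_feedback_receivedD[OF p[unfolded fb_def]] by auto
    then obtain u where u: "E v u" "emit K u l (\<sigma> u) = Transmit p" by blast
    have hook: "hook_end target (target (\<rho> v)) = hook_end target (\<rho> v)"
      using target_le[OF v] by (rule hook_end_hook)
    have "p = label_packet u (\<sigma> u) \<and> settled (\<sigma> u) \<and> \<not> settled (\<sigma> v) \<and>
        hook_end target (\<rho> v) = hook_end target (\<rho> u)"
      using l L u(2) hook unfolding relabel_slot_def
      by (auto simp: ag cur_hook[OF v] split: if_splits)
    then show ?thesis
      using u st p by (auto simp: label_packet_def)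
  qed
qed

lemma label_ok_step:
  assumes A: "agrees \<sigma>" and l: "relabel_slot l"
    and ok: "\<And>v. v \<in> V \<Longrightarrow> settled (\<sigma> v) \<Longrightarrow> label_ok \<sigma> v"
    and v: "v \<in> V" "settled (stp l \<sigma> v)"
  shows "label_ok (stp l \<sigma>) v"
proof -
  have keep: "stp l \<sigma> u = \<sigma> u" if "u \<in> V" "settled (\<sigma> u)" for u
    using relabel_step_cases[OF A l that(1)] that(2) by blast
  consider "stp l \<sigma> v = \<sigma> v" | u where "E v u" "settled (\<sigma> u)"
    "hook_end target (\<rho> v) = hook_end target (\<rho> u)"
    "stp l \<sigma> v = (\<sigma> v)\<lparr>nroot := nroot (\<sigma> u), ndep := Suc (ndep (\<sigma> u)), npar := u,
      msg := msg (\<sigma> u), settled := True\<rparr>"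
    using relabel_step_cases[OF A l v(1)] by blast
  then show ?thesis
  proof cases
    case 1
    then have ok': "label_ok \<sigma> v"
      using ok v by simp
    have "stp l \<sigma> (npar (\<sigma> v)) = \<sigma> (npar (\<sigma> v))" if "E v (npar (\<sigma> v))" "settled (\<sigma> (npar (\<sigma> v)))"
      using that by (intro keep edgeD(2))
    then show ?thesis
      using ok' 1 unfolding label_ok_def by auto
  next
    case (2 u)
    have uV: "u \<in> V" using 2(1) edgeD by blast
    have "label_ok \<sigma> u" "stp l \<sigma> u = \<sigma> u"
      using ok keep 2 uV by auto
    then show ?thesis
      using 2 unfolding label_ok_def by simp
  qed
qed

lemma label_ok_run:
  assumes "agrees \<sigma>" "\<And>l. l \<in> set ls \<Longrightarrow> relabel_slot l"
    and "\<And>v. v \<in> V \<Longrightarrow> settled (\<sigma> v) \<Longrightarrow> label_ok \<sigma> v"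
    and "v \<in> V" "settled (rn ls \<sigma> v)"
  shows "label_ok (rn ls \<sigma>) v"
  using assms
proof (induction ls arbitrary: \<sigma>)
  case (Cons l ls)
  have l: "relabel_slot l"
    using Cons.prems(2) by simp
  have A: "agrees (stp l \<sigma>)"
    using l Cons.prems(1) by (intro agrees_step) (auto simp: relabel_slot_def)
  have "label_ok (rn ls (stp l \<sigma>)) v"
  proof (rule Cons.IH[OF A])
    show "relabel_slot l'" if "l' \<in> set ls" for l'
      using Cons.prems(2) that by simp
    show "label_ok (stp l \<sigma>) w" if "w \<in> V" "settled (stp l \<sigma> w)" for w
      using label_ok_step[OF Cons.prems(1) l Cons.prems(3) that] .
    show "v \<in> V" "settled (rn ls (stp l \<sigma>) v)"
      using Cons.prems by simp_all
  qed
  then show ?case by simp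
qed simp

text \<open>A self-hooking cluster is settled as a whole, so the old parent of a settled vertex is
  settled too and the old tree may be kept.\<close>

lemma label_ok_init:
  assumes v: "v \<in> V" "settled (\<tau> v)"
  shows "label_ok \<tau> v"
proof -
  have t: "target (\<rho> u) = \<rho> u" if "u \<in> V" "settled (\<tau> u)" for u
    using settled_init[OF that(1)] that cur_hook(1)[OF that(1)] by (simp add: \<rho>_def)
  have he: "hook_end target (\<rho> v) = \<rho> v"
    using t[OF v] by (simp add: hook_end.simps[of target "\<rho> v"])
  have lab: "nroot (\<tau> u) = \<rho> u" "ndep (\<tau> u) = \<delta> u" "npar (\<tau> u) = \<pi> u" if "u \<in> V" for u
    using nlabels[OF that] by (simp_all add: \<rho>_def \<delta>_def \<pi>_def)
  have par: "settled (\<tau> (\<pi> v))" if "\<pi> v \<in> V" "\<rho> v = \<rho> (\<pi> v)"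
    using t[OF v] that settled_init[OF that(1)] cur_hook(1)[OF that(1)] by (simp add: \<rho>_def)
  have "\<rho> v = 0 \<Longrightarrow> msg (\<tau> v) = Some m"
    using msg_init[OF v(1)] by (simp add: \<rho>_def)
  then show ?thesis
    using forestD[OF forest' v(1)] he lab[OF v(1)] lab[of "\<pi> v"] par edgeD(2)[of v "\<pi> v"]
    unfolding label_ok_def by (elim disjE) auto
qed

lemma relabel_result:
  defines "\<sigma> \<equiv> rn (relabel_slots K n) \<tau>"
  shows "forest (\<lambda>v. nroot (\<sigma> v)) (\<lambda>v. ndep (\<sigma> v)) (\<lambda>v. npar (\<sigma> v))"
    "contracts V E \<rho> (\<lambda>v. nroot (\<sigma> v))"
    "\<And>v. v \<in> V \<Longrightarrow> nroot (\<sigma> v) = 0 \<Longrightarrow> msg (\<sigma> v) = Some m"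
proof -
  have ok: "label_ok \<sigma> v" if "v \<in> V" for v
    unfolding \<sigma>_def
  proof (rule label_ok_run[OF agrees_init _ label_ok_init that all_settled[OF that]])
    show "relabel_slot l" if "l \<in> set (relabel_slots K n)" for l
      using that by (auto simp: relabel_slots_def stage_slots_def set_grid relabel_slot_def)
  qed
  show "forest (\<lambda>v. nroot (\<sigma> v)) (\<lambda>v. ndep (\<sigma> v)) (\<lambda>v. npar (\<sigma> v))"
    unfolding forest_def
  proof
    fix v assume "v \<in> V"
    from ok[OF this] show "ndep (\<sigma> v) = 0 \<and> nroot (\<sigma> v) = key v \<or> ndep (\<sigma> v) \<noteq> 0 \<and> E v (npar (\<sigma> v)) \<and>
      ndep (\<sigma> v) = Suc (ndep (\<sigma> (npar (\<sigma> v)))) \<and> nroot (\<sigma> v) = nroot (\<sigma> (npar (\<sigma> v)))"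
      unfolding label_ok_def by blast
  qed
  show "msg (\<sigma> v) = Some m" if "v \<in> V" "nroot (\<sigma> v) = 0" for v
    using ok[OF that(1)] that(2) unfolding label_ok_def by blast
  show "contracts V E \<rho> (\<lambda>v. nroot (\<sigma> v))"
    unfolding contracts_def
  proof (intro exI[of _ target] conjI ballI allI impI)
    fix r assume "r \<in> \<rho> ` V"
    then obtain v where "v \<in> V" "r = \<rho> v" by blast
    then show "target r \<in> \<rho> ` V" "target r \<le> r"
      using hook_link(3,4)[of v] target_le[of v] by (metis image_eqI, simp)
  next
    fix x y assume "E x y"
    then show "target (\<rho> x) \<le> \<rho> y"
      using edgeD(1) by (intro target_le_edge) auto
  next
    fix v assume "v \<in> V"
    then show "nroot (\<sigma> v) = hook_end target (\<rho> v)"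
      using ok unfolding label_ok_def by blast
  qed
qed

end

section \<open>Correctness of the algorithm\<close>

context radio_network
begin

text \<open>The invariant between passes. Key 0 belongs to the source's cluster, so its members
  already know the message.\<close>

definition good :: "(nat \<Rightarrow> 'm st) \<Rightarrow> bool" where
  "good \<sigma> \<longleftrightarrow> forest (\<lambda>v. nroot (\<sigma> v)) (\<lambda>v. ndep (\<sigma> v)) (\<lambda>v. npar (\<sigma> v)) \<and>
     (\<forall>v\<in>V. nroot (\<sigma> v) = 0 \<longrightarrow> msg (\<sigma> v) = Some m)"

lemma run_pass:
  assumes "good \<sigma>"
  shows "good (rn (pass_slots K n) \<sigma>)"
    "contracts V E (\<lambda>v. nroot (\<sigma> v)) (\<lambda>v. nroot (rn (pass_slots K n) \<sigma> v))"
proof -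
  define \<sigma>1 where "\<sigma>1 = stp Start \<sigma>"
  have \<sigma>1: "root (\<sigma>1 v) = nroot (\<sigma> v)" "dep (\<sigma>1 v) = ndep (\<sigma> v)" "par (\<sigma>1 v) = npar (\<sigma> v)"
    "nroot (\<sigma>1 v) = nroot (\<sigma> v)" "ndep (\<sigma>1 v) = ndep (\<sigma> v)" "npar (\<sigma>1 v) = npar (\<sigma> v)"
    "msg (\<sigma>1 v) = msg (\<sigma> v)" "cur (\<sigma>1 v) = 0" "\<not> flag (\<sigma>1 v)" for v
    by (simp_all add: \<sigma>1_def step_def)
  have F: "forest (\<lambda>v. root (\<sigma>1 v)) (\<lambda>v. dep (\<sigma>1 v)) (\<lambda>v. par (\<sigma>1 v))"
    using assms by (simp add: \<sigma>1 good_def)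
  from search_phases[OF F] \<sigma>1(8,9) obtain c where
    c: "rn (search_slots K n) \<sigma>1 = (\<lambda>v. (\<sigma>1 v)\<lparr>cur := c v\<rparr>)"
    "\<forall>v\<in>V. c v = Min (links (\<lambda>v. root (\<sigma>1 v)) (root (\<sigma>1 v)))"
    by blast
  define \<tau> where "\<tau> = stp Decide (\<lambda>v. (\<sigma>1 v)\<lparr>cur := c v\<rparr>)"
  have \<tau>: "\<tau> v = (\<sigma>1 v)\<lparr>cur := c v, settled := (hook_root K (c v) = root (\<sigma>1 v))\<rparr>" for v
    by (simp add: \<tau>_def step_def)
  interpret R: relabelling V E s m K n \<tau>
  proof
    show "forest (\<lambda>v. root (\<tau> v)) (\<lambda>v. dep (\<tau> v)) (\<lambda>v. par (\<tau> v))"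
      using F by (simp add: \<tau>)
    fix v assume v: "v \<in> V"
    show "cur (\<tau> v) = Min (links (\<lambda>v. root (\<tau> v)) (root (\<tau> v)))"
      using c(2) v by (simp add: \<tau>)
    show "settled (\<tau> v) \<longleftrightarrow> hook_root K (cur (\<tau> v)) = root (\<tau> v)"
      by (simp add: \<tau>)
    show "nroot (\<tau> v) = root (\<tau> v) \<and> ndep (\<tau> v) = dep (\<tau> v) \<and> npar (\<tau> v) = par (\<tau> v)"
      by (simp add: \<tau> \<sigma>1)
    show "msg (\<tau> v) = Some m" if "root (\<tau> v) = 0"
      using that assms v by (simp add: \<tau> \<sigma>1 good_def)
  qed
  have run: "rn (pass_slots K n) \<sigma> = rn (relabel_slots K n) \<tau>"
    using c(1) by (simp add: pass_slots_def \<sigma>1_def \<tau>_def)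
  have "R.\<rho> = (\<lambda>v. nroot (\<sigma> v))"
    by (simp add: R.\<rho>_def fun_eq_iff \<tau> \<sigma>1)
  then show "good (rn (pass_slots K n) \<sigma>)"
    "contracts V E (\<lambda>v. nroot (\<sigma> v)) (\<lambda>v. nroot (rn (pass_slots K n) \<sigma> v))"
    using R.relabel_result by (simp_all add: good_def run)
qed

lemma run_passes:
  assumes "v \<in> V"
  shows "msg (rn (concat (replicate (2 * bits n) (pass_slots K n)))
    (\<lambda>v. init_st v (input_of s m v)) v) = Some m"
proof -
  define \<sigma> where "\<sigma> i = rn (concat (replicate i (pass_slots K n))) (\<lambda>v. init_st v (input_of s m v))" for i
  define f where "f i v = nroot (\<sigma> i v)" for i v
  have \<sigma>_Suc: "\<sigma> (Suc i) = rn (pass_slots K n) (\<sigma> i)" for i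
  proof -
    have "concat (replicate (Suc i) xs) = concat (replicate i xs) @ xs" for xs :: "slot list"
      by (induction i) simp_all
    then show ?thesis
      by (simp add: \<sigma>_def del: replicate_Suc)
  qed
  have f0: "f 0 v = key v" for v
    by (simp add: f_def \<sigma>_def init_st_def input_of_def key_def)
  have good: "good (\<sigma> i)" for i
  proof (induction i)
    case 0
    show ?case
      using id_bounds(1)
      by (auto simp: good_def forest_def \<sigma>_def init_st_def input_of_def key_def)
  next
    case (Suc i)
    then show ?case
      using run_pass(1) \<sigma>_Suc by simp
  qed
  have contr: "contracts V E (f i) (f (Suc i))" for i
    using run_pass(2)[OF good] \<sigma>_Suc by (simp add: f_def[abs_def])
  \<comment> \<open>Key 0 is the end of its own chain, so the source keeps it for ever and the last
    cluster must carry it.\<close>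
  have src: "f i s = 0" for i
  proof (induction i)
    case 0
    show ?case by (simp add: f0 key_def)
  next
    case (Suc i)
    then show ?case
      using contr[of i] source by (auto simp: contracts_def)
  qed
  \<comment> \<open>At most \<open>n\<close> clusters exist initially and
    \<open>n < 2 ^ bits n\<close>, so \<open>bits n\<close> halvings are impossible and the
    absorbing case has occurred.\<close>
  have "card (f (2 * bits n) ` V) = 1"
  proof -
    have "card (f 0 ` V) \<le> n"
      using card_image_le[OF finite_V] card_V by simp
    also have "n < 2 ^ bits n"
      by (rule less_power_bits)
    finally have small: "card (f 0 ` V) < 2 ^ bits n" .
    have "card (f (2 * bits n) ` V) \<noteq> 0"
      using finite_V source by auto
    then have "2 ^ bits n \<le> 2 ^ bits n * card (f (2 * bits n) ` V)"
      by simp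
    moreover have "card (f (2 * bits n) ` V) = 1 \<or>
        2 ^ bits n * card (f (2 * bits n) ` V) \<le> card (f 0 ` V)"
      using network contr by (rule contracts_iterate)
    ultimately show ?thesis
      using small by linarith
  qed
  then obtain r where "f (2 * bits n) ` V = {r}"
    by (auto simp: card_1_singleton_iff)
  then have "f (2 * bits n) v = f (2 * bits n) s"
    using assms source by (metis imageI singletonD)
  then have "nroot (\<sigma> (2 * bits n) v) = 0"
    using src by (simp add: f_def)
  then show ?thesis
    using good[of "2 * bits n"] assms by (simp add: good_def \<sigma>_def)
qed

end

section \<open>Numerical bounds and assembly\<close>

lemma schedule_bounds:
  assumes "2 \<le> n" "n \<le> N"
  shows "real (length (schedule N n)) \<le> 464 * (real n * real N ^ 2 * log 2 (real N) * log 2 (real n))"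
    "real (2 * bits n * (18 * bits N + 6)) \<le> 464 * (log 2 (real N) ^ 3 * log 2 (real n))"
proof -
  define a where "a = log 2 (real N)"
  define b where "b = log 2 (real n)"
  have a: "a \<ge> 1" and b: "b \<ge> 1"
    using assms by (simp_all add: a_def b_def le_log_iff)
  have N: "real (bits N) \<le> 2 * a" "real (2 ^ bits N) \<le> 2 * real N"
    and n: "real (bits n) \<le> 2 * b"
    using bits_le_log[of N] bits_le_log[of n] assms by (simp_all add: a_def b_def)
  have "length (schedule N n) = 2 * bits n * length (pass_slots (bits N) n)"
    by (simp add: schedule_def length_concat sum_list_replicate)
  also have "\<dots> \<le> 2 * bits n * ((12 * bits N + 5) * (n * (2 ^ bits N) ^ 2))"
    using assms by (intro mult_le_mono2 length_pass_slots) simp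
  finally have "real (length (schedule N n)) \<le> real (2 * bits n * ((12 * bits N + 5) * (n * (2 ^ bits N) ^ 2)))"
    by (rule of_nat_mono)
  also have "\<dots> = 2 * real (bits n) * ((12 * real (bits N) + 5) * (real n * real (2 ^ bits N) ^ 2))"
    by simp
  \<comment> \<open>\<open>12 * (2 * a) + 5 \<le> 29 * a\<close> because \<open>a \<ge> 1\<close>.
    The factors 4 from the passes, 29, and 4 from squaring \<open>2 * N\<close> multiply to
    464.\<close>
  also have "\<dots> \<le> 2 * (2 * b) * ((29 * a) * (real n * (2 * real N) ^ 2))"
    using N n a b by (intro mult_mono power_mono) auto
  also have "\<dots> = 464 * (real n * real N ^ 2 * a * b)"
    by (simp add: power2_eq_square)
  finally show "real (length (schedule N n)) \<le> 464 * (real n * real N ^ 2 * log 2 (real N) * log 2 (real n))"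
    by (simp add: a_def b_def)
  \<comment> \<open>The energy of the schedule is linear in \<open>a\<close>; this inequality, with
    \<open>18 * (2 * a) + 6 \<le> 42 * a\<close>, lifts it to the cubic bound, where
    \<open>4 * 42 \<le> 464\<close>.\<close>
  have "a \<le> a ^ 3"
    using a by (intro self_le_power) auto
  have "real (2 * bits n * (18 * bits N + 6)) = 2 * real (bits n) * (18 * real (bits N) + 6)"
    by simp
  also have "\<dots> \<le> 2 * (2 * b) * (42 * a ^ 3)"
    using N n a b \<open>a \<le> a ^ 3\<close> by (intro mult_mono) auto
  also have "\<dots> \<le> 464 * (a ^ 3 * b)"
    using a b by simp
  finally show "real (2 * bits n * (18 * bits N + 6)) \<le> 464 * (log 2 (real N) ^ 3 * log 2 (real n))"
    by (simp add: a_def b_def)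
qed

lemma bc_solves_broadcast:
  fixes m :: 'm
  assumes net: "is_network V E" and V: "V \<subseteq> {1..N}" "card V = n" and s: "s \<in> V"
    and en: "real (2 * bits n * (18 * bits N + 6)) \<le> En"
  shows "solves_broadcast bc_act bc_out N n V E s m (length (schedule N n)) En"
  unfolding solves_broadcast_def
proof (intro conjI ballI allI impI)
  interpret radio_network V E s m "bits N" n
  proof
    show "V \<subseteq> {0<..<2 ^ bits N}"
      using V less_power_bits[of N] by fastforce
  qed (use assms in auto)
  let ?T = "length (schedule N n)"
  fix v assume v: "v \<in> V"
  have len: "length (history bc_act N n V E s m t v) = t" for t
    by (induction t) (simp_all add: Let_def)
  show "action_at bc_act N n V E s m t v = Idle" if "?T \<le> t" for t
    using that len[of t] by (simp add: action_at_def bc_act_def)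
  have "energy_upto bc_act N n V E s m ?T v \<le> 2 * bits n * (18 * bits N + 6)"
    using energy_upto_simulates[of ?T N n V E s m v] passes_energy[of "bits N" V E v "2 * bits n" n]
    by (simp add: schedule_def)
  then show "real (energy_upto bc_act N n V E s m ?T v) \<le> En"
    using en by (meson of_nat_mono order_trans)
  show "bc_out N n v (input_of s m v) (history bc_act N n V E s m ?T v) = Some m"
    using history_simulates[of ?T N n V E s m v] run_passes[OF v]
    by (simp add: bc_out_def schedule_def)
qed

theorem theorem10:
  "\<exists>(act :: 'm alg_act) (out :: 'm alg_out) (C :: real). C > 0 \<and>
     (\<forall>N n V E s (m :: 'm).
        is_network V E \<and> V \<subseteq> {1..N} \<and> card V = n \<and> n \<ge> 2 \<and> s \<in> V \<longrightarrow>
        (\<exists>T. real T \<le> C * (real n * real N ^ 2 * log 2 (real N) * log 2 (real n)) \<and>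
             solves_broadcast act out N n V E s m T
               (C * (log 2 (real N) ^ 3 * log 2 (real n)))))"
proof (rule exI[of _ bc_act], rule exI[of _ bc_out], rule exI[of _ 464], intro conjI allI impI)
  fix N n V E s and m :: 'm
  assume *: "is_network V E \<and> V \<subseteq> {1..N} \<and> card V = n \<and> n \<ge> 2 \<and> s \<in> V"
  then have "n \<le> N"
    using card_mono[of "{1..N}" V] by simp
  then have n: "2 \<le> n" "n \<le> N"
    using * by simp_all
  show "\<exists>T. real T \<le> 464 * (real n * real N ^ 2 * log 2 (real N) * log 2 (real n)) \<and>
      solves_broadcast bc_act bc_out N n V E s m T (464 * (log 2 (real N) ^ 3 * log 2 (real n)))"
    using * schedule_bounds[OF n]
    by (intro exI[of _ "length (schedule N n)"] conjI bc_solves_broadcast) simp_all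
qed simp

end
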